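(* Let $f:S^1\to S^1$ be a $C^3$ critical circle map with irrational rotation number, and let $\mu$ be its unique invariant Borel probability measure. Then $\log Df$ belongs to $L^1(\mu)$ and it has zero mean: $$\int_{S^1}\log Df\,d\mu=0.$$ Moreover, no critical point of $f$ satisfies the Collet-Eckmann condition.
   Context: A $C^3$ critical circle map is an orientation preserving $C^3$ circle homeomorphism $f:S^1\to S^1$ with finitely many critical points $c_1,\dots,c_N$ ($N\geq 1$), all of which are non-flat. A critical point $c$ is non-flat if in a neighbourhood of $c$ one can write $f(t)=\phi(t)\,|\phi(t)|^{d-1}+f(c)$, where $\phi$ is a $C^3$ local diffeomorphism with $\phi(c)=0$ and $d>1$ is a real number (the criticality of $c$). $Df$ denotes the derivative of $f$ (of a lift of $f$ to the real line), which is non-negative and vanishes exactly at $c_1,\dots,c_N$; $\log Df$ is defined on $S^1\setminus\{c_1,\dots,c_N\}$. Since the rotation number is irrational, $f$ is uniquely ergodic. The map $f$ satisfies the Collet-Eckmann condition at a critical point $c$ if there exist $C>0$ and $\lambda>1$ such that $Df^n(f(c))\geq C\lambda^n$ for all $n\in\mathbb{N}$, where $f^n$ is the $n$-th iterate. *)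

theory Defs
  imports "HOL-Probability.Probability"
begin

abbreviation circle :: "complex set" where
  "circle \<equiv> sphere 0 1"

text \<open>The universal covering of the circle; it identifies \<open>\<real>/\<int>\<close> with the unit circle, so derivatives
  below are taken with respect to the coordinate of period 1.\<close>

definition circle_proj :: "real \<Rightarrow> complex" where
  "circle_proj t = cis (2 * pi * t)"

definition circle_lift :: "(complex \<Rightarrow> complex) \<Rightarrow> (real \<Rightarrow> real) \<Rightarrow> bool" where
  "circle_lift f F \<longleftrightarrow>
     continuous_on UNIV F \<and> (\<forall>t. f (circle_proj t) = circle_proj (F t))"

text \<open>\<open>Ck_on k U g\<close> is meant for open \<open>U\<close>: all derivatives of \<open>g\<close> up to order \<open>k\<close> exist on \<open>U\<close>, and
  the last one is continuous there.\<close>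

definition Ck_on :: "nat \<Rightarrow> real set \<Rightarrow> (real \<Rightarrow> real) \<Rightarrow> bool" where
  "Ck_on k U g \<longleftrightarrow>
     (\<forall>j<k. \<forall>x\<in>U. (deriv ^^ j) g differentiable (at x)) \<and> continuous_on U ((deriv ^^ k) g)"

definition Ck_diffeo :: "nat \<Rightarrow> real set \<Rightarrow> real set \<Rightarrow> (real \<Rightarrow> real) \<Rightarrow> bool" where
  "Ck_diffeo k U V \<phi> \<longleftrightarrow> open U \<and> open V \<and>
     (\<exists>\<psi>. homeomorphism U V \<phi> \<psi> \<and> Ck_on k U \<phi> \<and> Ck_on k V \<psi>)"

definition orientation_preserving_circle_homeo :: "(complex \<Rightarrow> complex) \<Rightarrow> bool" where
  "orientation_preserving_circle_homeo f \<longleftrightarrow>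
     (\<exists>g. homeomorphism circle circle f g) \<and> (\<exists>F. circle_lift f F \<and> strict_mono F)"

definition Ck_circle_map :: "nat \<Rightarrow> (complex \<Rightarrow> complex) \<Rightarrow> bool" where
  "Ck_circle_map k f \<longleftrightarrow> (\<exists>F. circle_lift f F \<and> Ck_on k UNIV F)"

text \<open>The value does not depend on the choices of \<open>F\<close> and \<open>t\<close>: any two lifts differ by an integer
  constant, and the derivative of a lift has period 1.\<close>

definition circle_deriv :: "(complex \<Rightarrow> complex) \<Rightarrow> complex \<Rightarrow> real" where
  "circle_deriv f z =
     (THE d. \<exists>F t. circle_lift f F \<and> circle_proj t = z \<and> (F has_real_derivative d) (at t))"

definition critical_points :: "(complex \<Rightarrow> complex) \<Rightarrow> complex set" where
  "critical_points f = {z \<in> circle. circle_deriv f z = 0}"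

definition nonflat :: "(complex \<Rightarrow> complex) \<Rightarrow> complex \<Rightarrow> bool" where
  "nonflat f c \<longleftrightarrow>
     (\<exists>F s U V \<phi> d. circle_lift f F \<and> circle_proj s = c \<and> s \<in> U \<and>
        Ck_diffeo 3 U V \<phi> \<and> \<phi> s = 0 \<and> d > 1 \<and>
        (\<forall>t\<in>U. F t = \<phi> t * \<bar>\<phi> t\<bar> powr (d - 1) + F s))"

definition C3_critical_circle_map :: "(complex \<Rightarrow> complex) \<Rightarrow> bool" where
  "C3_critical_circle_map f \<longleftrightarrow>
     orientation_preserving_circle_homeo f \<and> Ck_circle_map 3 f \<and>
     finite (critical_points f) \<and> critical_points f \<noteq> {} \<and>
     (\<forall>c\<in>critical_points f. nonflat f c)"

text \<open>The translation number of a lift is independent of the base point \<open>x\<close>, and its class in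
  \<open>\<real>/\<int>\<close>, represented by its fractional part, is independent of the lift.\<close>

definition rotation_number :: "(complex \<Rightarrow> complex) \<Rightarrow> real" where
  "rotation_number f =
     (THE \<rho>. \<exists>F x \<tau>. circle_lift f F \<and>
        (\<lambda>n. ((F ^^ n) x - x) / real n) \<longlonglongrightarrow> \<tau> \<and> \<rho> = frac \<tau>)"

definition invariant_borel_prob :: "(complex \<Rightarrow> complex) \<Rightarrow> complex measure \<Rightarrow> bool" where
  "invariant_borel_prob f \<mu> \<longleftrightarrow>
     prob_space \<mu> \<and> sets \<mu> = sets (restrict_space borel circle) \<and> distr \<mu> \<mu> f = \<mu>"

definition collet_eckmann :: "(complex \<Rightarrow> complex) \<Rightarrow> complex \<Rightarrow> bool" where
  "collet_eckmann f c \<longleftrightarrow>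
     (\<exists>C>0. \<exists>l>1. \<forall>n. circle_deriv (f ^^ n) (f c) \<ge> C * l ^ n)"

text \<open>\<open>log Df\<close> is only defined off the critical points, whereas HOL has \<open>ln 0 = 0\<close>. Belonging to
  \<open>L\<^sup>1(\<mu>)\<close> therefore includes that it is defined \<open>\<mu>\<close>-almost everywhere.\<close>

definition log_deriv_in_L1 :: "(complex \<Rightarrow> complex) \<Rightarrow> complex measure \<Rightarrow> bool" where
  "log_deriv_in_L1 f \<mu> \<longleftrightarrow>
     (AE z in \<mu>. z \<notin> critical_points f) \<and> integrable \<mu> (\<lambda>z. ln (circle_deriv f z))"

end

theory Submission
  imports Defs "HOL-Real_Asymp.Real_Asymp"
begin

text \<open>
  The proof uses two facts about \<open>f\<close>: its lift \<open>F\<close> has a Lipschitz derivative, and it has no periodic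
  points, because a periodic orbit would make the rotation number rational.

  Absence of periodic points forbids contraction. If an interval around a point \<open>x\<close> contains
  \<open>y = F\<^sup>k x - p\<close> with \<open>k \<ge> 1\<close>, then the distance between the iterates of \<open>x\<close> and of \<open>y\<close>, forward or
  backward, is a displacement of the map \<open>F\<^sup>k - p\<close>, and these are bounded away from 0 by compactness.
  So the interval cannot shrink to a point under the iterates of \<open>F\<close> or of its inverse
  (\<open>no_forward_contraction\<close>, \<open>no_backward_contraction\<close>). By Poincare recurrence, every set of positive
  measure contains points with returns as close as desired (\<open>close_return\<close>).

  Let \<open>D\<close> be the derivative on the circle and \<open>\<mu>\<close> an invariant probability measure. A mean of \<open>ln D\<close>
  different from 0 would produce contraction. If \<open>\<integral> ln (max D s) d\<mu> < 0\<close> for some \<open>s > 0\<close>, then the maximal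
  ergodic theorem gives points at which every forward orbit sum is very negative, and intervals of a
  uniform size around them contract (\<open>integral_ln_max_nonneg\<close>). Hence all truncated means are non-negative;
  letting \<open>s\<close> tend to 0 shows that \<open>ln D\<close> is integrable with mean at least 0 (\<open>log_deriv_integrable\<close>).

  If the mean were positive, the inverse map would contract around suitable points. The difficulty is
  that the inverse has unbounded derivative near critical values. The pulled back interval must be short
  compared with the derivative at its centre at each time, and this is enforced by applying the maximal
  ergodic theorem not to \<open>ln D\<close> but to \<open>ln D + min (ln D + M) 0 - 2 \<delta>\<close>, which still has positive mean if \<open>M\<close>
  is large and \<open>\<delta>\<close> small (\<open>deep_orbit_backward_contracts\<close>, \<open>integral_log_deriv_nonpos\<close>).

  Finally, along the orbit of a critical value that satisfies the Collet-Eckmann condition the empirical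
  measures accumulate at an invariant measure for which \<open>ln D\<close> has positive mean (\<open>not_collet_eckmann\<close>),
  contrary to what was shown.\<close>

section \<open>Lifts of circle maps\<close>

lemma circle_proj_in_circle [simp]: "circle_proj t \<in> circle"
  by (simp add: circle_proj_def)

lemma norm_circle_proj [simp]: "norm (circle_proj t) = 1"
  by (simp add: circle_proj_def)

lemma circle_proj_eq_iff: "circle_proj t = circle_proj u \<longleftrightarrow> (\<exists>p::int. t = u + of_int p)"
proof -
  have "circle_proj t = circle_proj u \<longleftrightarrow> (\<exists>n::int. 2 * pi * t = 2 * pi * u + 2 * pi * n)"
    unfolding circle_proj_def complex_eq_iff using sin_cos_eq_iff[of "2 * pi * t" "2 * pi * u"]
    by (auto simp: algebra_simps)
  also have "\<dots> \<longleftrightarrow> (\<exists>p::int. t = u + of_int p)"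
  proof -
    have "2 * pi * t = 2 * pi * u + 2 * pi * n \<longleftrightarrow> t = u + of_int n" for n :: int
      by (simp add: distrib_left[symmetric] mult.assoc)
    then show ?thesis by simp
  qed
  finally show ?thesis .
qed

lemma circle_proj_add_int [simp]: "circle_proj (t + of_int p) = circle_proj t"
  by (auto simp: circle_proj_eq_iff)

lemma circle_proj_surj: "z \<in> circle \<Longrightarrow> \<exists>t\<in>{0..1}. circle_proj t = z"
proof -
  assume "z \<in> circle"
  then obtain t where t: "0 \<le> t" "t < 2 * pi" "z = cis t"
    using Arg2pi[of z] by (auto simp: cis_conv_exp is_Arg_def)
  show ?thesis
    using t by (intro bexI[of _ "t / (2 * pi)"]) (auto simp: circle_proj_def)
qed

lemma continuous_on_circle_proj [continuous_intros]: "continuous_on A circle_proj"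
  unfolding circle_proj_def by (intro continuous_intros)

text \<open>The covering is a closed map on a compact interval that covers the circle, so a function on the
  circle is continuous as soon as its periodic pull-back is.\<close>

lemma continuous_on_circleI:
  fixes h :: "complex \<Rightarrow> 'a::metric_space"
  assumes "continuous_on UNIV (\<lambda>t. h (circle_proj t))"
  shows "continuous_on circle h"
proof (subst continuous_on_closed_vimage[OF closed_sphere], intro allI impI)
  fix B :: "'a set" assume B: "closed B"
  have "closed ((\<lambda>t. h (circle_proj t)) -` B)"
    using B assms by (simp add: continuous_closed_vimage continuous_on_eq_continuous_at)
  then have "compact ({0..1} \<inter> (\<lambda>t. h (circle_proj t)) -` B)"
    by (simp add: compact_Int_closed)
  then have "compact (circle_proj ` ({0..1} \<inter> (\<lambda>t. h (circle_proj t)) -` B))"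
    by (intro compact_continuous_image continuous_intros)
  moreover have "circle_proj ` ({0..1} \<inter> (\<lambda>t. h (circle_proj t)) -` B) = h -` B \<inter> circle"
    using circle_proj_surj by fastforce
  ultimately show "closed (h -` B \<inter> circle)"
    using compact_imp_closed by metis
qed

lemma circle_lift_proj: "circle_lift f F \<Longrightarrow> f (circle_proj t) = circle_proj (F t)"
  by (simp add: circle_lift_def)

lemma int_valued_continuous_const:
  fixes h :: "real \<Rightarrow> real"
  assumes "continuous_on UNIV h" "\<And>t. h t \<in> \<int>"
  obtains p :: int where "\<And>t. h t = of_int p"
proof -
  have "h constant_on UNIV"
  proof (rule continuous_discrete_range_constant[OF connected_UNIV assms(1)])
    fix x
    have "1 \<le> norm (h y - h x)" if "h y \<noteq> h x" for y
      using Ints_nonzero_abs_ge1[of "h y - h x"] that assms(2) by auto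
    then show "\<exists>e>0. \<forall>y. y \<in> UNIV \<and> h y \<noteq> h x \<longrightarrow> e \<le> norm (h y - h x)"
      by (intro exI[of _ 1]) auto
  qed
  then obtain c where "\<And>t. h t = c" by (auto simp: constant_on_def)
  moreover from this have "c \<in> \<int>" using assms(2)[of 0] by simp
  ultimately show ?thesis using that by (metis Ints_cases)
qed

lemma circle_lift_unique:
  assumes "circle_lift f F" "circle_lift f H"
  obtains p :: int where "\<And>t. H t = F t + of_int p"
proof -
  have "H t - F t \<in> \<int>" for t
    using assms circle_proj_eq_iff[of "H t" "F t"] by (auto simp: circle_lift_def)
  moreover have "continuous_on UNIV (\<lambda>t. H t - F t)"
    using assms by (auto simp: circle_lift_def intro: continuous_intros)
  ultimately obtain p :: int where "\<And>t. H t - F t = of_int p"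
    using int_valued_continuous_const[of "\<lambda>t. H t - F t"] by metis
  then show ?thesis using that[of p] by (metis add.commute diff_add_cancel)
qed

lemma circle_lift_degree:
  assumes "circle_lift f F"
  obtains m :: int where "\<And>t. F (t + 1) = F t + of_int m"
proof -
  have "circle_lift f (\<lambda>t. F (t + 1))"
    unfolding circle_lift_def
  proof (intro conjI allI)
    show "continuous_on UNIV (\<lambda>t. F (t + 1))"
      by (rule continuous_on_compose2[of UNIV F])
        (use assms in \<open>auto simp: circle_lift_def intro!: continuous_on_add continuous_on_id continuous_on_const\<close>)
    show "f (circle_proj t) = circle_proj (F (t + 1))" for t
      using circle_lift_proj[OF assms, of "t + 1"] circle_proj_add_int[of t 1] by simp
  qed
  from circle_lift_unique[OF assms this] show ?thesis using that by blast
qed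

lemma add_int_equivariant:
  fixes F :: "real \<Rightarrow> real" and m p :: int
  assumes "\<And>t. F (t + 1) = F t + of_int m"
  shows "F (t + of_int p) = F t + of_int (m * p)"
proof (induction p arbitrary: t rule: int_induct[of _ 0])
  case (step1 i)
  have "F (t + of_int (i + 1)) = F ((t + of_int i) + 1)" by (simp add: add.assoc)
  also have "\<dots> = F t + of_int (m * i) + of_int m" using step1 assms by metis
  finally show ?case by (simp add: distrib_left)
next
  case (step2 i)
  have "F (t + of_int i) = F ((t + of_int (i - 1)) + 1)" by simp
  also have "\<dots> = F (t + of_int (i - 1)) + of_int m" by (rule assms)
  finally have "F (t + of_int (i - 1)) = F t + of_int (m * i) - of_int m" using step2 by simp
  then show ?case by (simp add: right_diff_distrib)
qed simp

text \<open>Two lifts differ by a constant and a lift commutes with integer translations up to constants, so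
  the derivative at a point does not depend on the choices.\<close>

lemma circle_deriv_eq:
  assumes lift: "circle_lift f F" and der: "(F has_real_derivative d) (at t)"
  shows "circle_deriv f (circle_proj t) = d"
  unfolding circle_deriv_def
proof (rule the_equality)
  show "\<exists>F u. circle_lift f F \<and> circle_proj u = circle_proj t \<and> (F has_real_derivative d) (at u)"
    using assms by blast
next
  fix e
  assume "\<exists>F u. circle_lift f F \<and> circle_proj u = circle_proj t \<and> (F has_real_derivative e) (at u)"
  then obtain H u where H: "circle_lift f H" "circle_proj u = circle_proj t"
      "(H has_real_derivative e) (at u)" by blast
  obtain p :: int where p: "u = t + of_int p" using H(2) circle_proj_eq_iff by blast
  obtain q :: int where q: "\<And>s. H s = F s + of_int q" using circle_lift_unique[OF lift H(1)] by metis
  obtain m :: int where m: "\<And>s. F (s + 1) = F s + of_int m" using circle_lift_degree[OF lift] by metis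
  have eq: "H (s + of_int p) = F s + (of_int q + of_int (m * p))" for s
    using q add_int_equivariant[of F m s p, OF m] by simp
  have "((\<lambda>s. H (s + of_int p)) has_real_derivative e) (at t)"
    using H(3) p by (simp add: DERIV_shift)
  then have "((\<lambda>s. F s + (of_int q + of_int (m * p))) has_real_derivative e) (at t)"
    by (simp only: eq)
  moreover have "((\<lambda>s. F s + (of_int q + of_int (m * p))) has_real_derivative d + 0) (at t)"
    by (rule DERIV_add[OF der DERIV_const])
  ultimately show "e = d" using DERIV_unique by fastforce
qed

lemma circle_lift_funpow:
  assumes "circle_lift f F"
  shows "circle_lift (f ^^ n) (F ^^ n)"
proof (induction n)
  case 0
  then show ?case by (simp add: circle_lift_def)
next
  case (Suc n)
  have "continuous_on UNIV (F \<circ> (F ^^ n))"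
    using Suc assms unfolding circle_lift_def
    by (intro continuous_on_compose) (auto intro: continuous_on_subset)
  then show ?case using Suc assms by (simp add: circle_lift_def o_def)
qed

text \<open>The degree of an increasing lift is positive, and if it were at least 2 then the lift would
  gain 1 strictly inside a fundamental interval, which contradicts injectivity on the circle.\<close>

lemma circle_homeo_lift_degree_one:
  assumes lift: "circle_lift f F" and inj: "inj_on f circle" and mono: "strict_mono F"
  shows "F (t + 1) = F t + 1"
proof -
  obtain m :: int where m: "\<And>s. F (s + 1) = F s + of_int m" using circle_lift_degree[OF lift] by metis
  have "F t < F (t + 1)" using mono by (simp add: strict_mono_def)
  then have m1: "m \<ge> 1" using m[of t] by simp
  have "\<not> m \<ge> 2"
  proof
    assume "m \<ge> 2"
    then have "F t \<le> F t + 1" "F t + 1 < F (t + 1)"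
      using m[of t] by linarith+
    moreover have "continuous_on {t..t+1} F"
      using lift unfolding circle_lift_def by (meson continuous_on_subset top_greatest)
    ultimately obtain s where s: "t \<le> s" "s \<le> t + 1" "F s = F t + 1"
      using IVT'[of F t "F t + 1" "t + 1"] by fastforce
    have "s \<noteq> t" using s by auto
    moreover have "s \<noteq> t + 1" using s \<open>F t + 1 < F (t + 1)\<close> by auto
    ultimately have s': "t < s" "s < t + 1" using s by auto
    have "f (circle_proj s) = f (circle_proj t)"
      using circle_lift_proj[OF lift] s(3) circle_proj_add_int[of "F t" 1] by simp
    then have "circle_proj s = circle_proj t" using inj by (auto simp: inj_on_def)
    then obtain p :: int where "s = t + of_int p" by (auto simp: circle_proj_eq_iff)
    then have "0 < p" "p < 1" using s' by simp_all
    then show False by simp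
  qed
  then have "m = 1" using m1 by simp
  then show ?thesis using m by simp
qed


section \<open>Periodic orbits and the rotation number\<close>

lemma funpow_add_int:
  fixes F :: "real \<Rightarrow> real"
  assumes "\<And>t. F (t + 1) = F t + (1::real)"
  shows "(F ^^ n) (t + of_int p) = (F ^^ n) t + of_int p"
  using add_int_equivariant[of F 1, simplified, OF assms] by (induction n) simp_all

text \<open>This discharges the uniqueness in the definite description: another base point moves the orbit by
  a bounded amount because the iterates are monotone and commute with integer translations, and
  another lift changes the limit by an integer.\<close>

lemma rotation_number_eq:
  assumes lift: "circle_lift f F" and mono: "strict_mono F" and deg: "\<And>t. F (t + 1) = F t + 1"
    and lim: "(\<lambda>n. ((F ^^ n) x - x) / real n) \<longlonglongrightarrow> \<tau>"
  shows "rotation_number f = frac \<tau>"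
  unfolding rotation_number_def
proof (rule the_equality)
  show "\<exists>F x \<sigma>. circle_lift f F \<and> (\<lambda>n. ((F ^^ n) x - x) / real n) \<longlonglongrightarrow> \<sigma> \<and> frac \<tau> = frac \<sigma>"
    using lift lim by blast
next
  fix \<rho>
  assume "\<exists>F x \<sigma>. circle_lift f F \<and> (\<lambda>n. ((F ^^ n) x - x) / real n) \<longlonglongrightarrow> \<sigma> \<and> \<rho> = frac \<sigma>"
  then obtain H y \<sigma> where H: "circle_lift f H" "(\<lambda>n. ((H ^^ n) y - y) / real n) \<longlonglongrightarrow> \<sigma>" "\<rho> = frac \<sigma>"
    by blast
  obtain p :: int where p: "\<And>t. H t = F t + of_int p" using circle_lift_unique[OF lift H(1)] by metis
  have F_add: "F (t + of_int q) = F t + of_int q" for t q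
    using add_int_equivariant[of F 1, simplified, OF deg] by simp
  have Hn: "(H ^^ n) y = (F ^^ n) y + real n * of_int p" for n
  proof (induction n)
    case (Suc n)
    have "(H ^^ Suc n) y = F ((F ^^ n) y + of_int (int n * p)) + of_int p"
      using Suc p[of "(H ^^ n) y"] by simp
    also have "\<dots> = (F ^^ Suc n) y + real (Suc n) * of_int p"
      by (simp only: F_add) (simp add: algebra_simps)
    finally show ?case .
  qed simp
  have mono_n: "mono (F ^^ n)" for n
    using mono strict_mono_mono by (intro mono_pow) blast
  define q where "q = \<lceil>\<bar>y - x\<bar>\<rceil>"
  have q: "\<bar>y - x\<bar> \<le> of_int q" by (simp add: q_def)
  have near: "\<bar>(F ^^ n) y - (F ^^ n) x\<bar> \<le> of_int q" for n
  proof -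
    have "(F ^^ n) y \<le> (F ^^ n) (x + of_int q)" "(F ^^ n) x \<le> (F ^^ n) (y + of_int q)"
      by (rule monoD[OF mono_n], use q in linarith)+
    then show ?thesis unfolding funpow_add_int[of F, OF deg] by linarith
  qed
  have "(\<lambda>n. ((F ^^ n) y - (F ^^ n) x - (y - x)) / real n) \<longlonglongrightarrow> 0"
  proof (rule Lim_null_comparison)
    show "(\<lambda>n. (2 * of_int q) / real n) \<longlonglongrightarrow> 0" by (rule lim_const_over_n)
    show "\<forall>\<^sub>F n in sequentially. norm (((F ^^ n) y - (F ^^ n) x - (y - x)) / real n) \<le> (2 * of_int q) / real n"
    proof (intro always_eventually allI)
      fix n
      have "\<bar>(F ^^ n) y - (F ^^ n) x - (y - x)\<bar> \<le> 2 * of_int q" using near[of n] q by linarith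
      then show "norm (((F ^^ n) y - (F ^^ n) x - (y - x)) / real n) \<le> (2 * of_int q) / real n"
        by (simp add: abs_divide divide_right_mono)
    qed
  qed
  from tendsto_add[OF tendsto_add[OF this lim] tendsto_const[of "of_int p"]]
  have "(\<lambda>n. ((F ^^ n) y - (F ^^ n) x - (y - x)) / real n + ((F ^^ n) x - x) / real n + of_int p)
      \<longlonglongrightarrow> \<tau> + of_int p" by simp
  moreover have "\<forall>\<^sub>F n in sequentially. ((F ^^ n) y - (F ^^ n) x - (y - x)) / real n + ((F ^^ n) x - x) / real n
      + of_int p = ((H ^^ n) y - y) / real n"
    by (rule eventually_mono[OF eventually_gt_at_top[of 0]]) (simp add: Hn field_simps)
  ultimately have "(\<lambda>n. ((H ^^ n) y - y) / real n) \<longlonglongrightarrow> \<tau> + of_int p"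
    by (rule Lim_transform_eventually)
  then have "\<sigma> = \<tau> + of_int p" using H(2) LIMSEQ_unique by blast
  then show "\<rho> = frac \<tau>" using H(3) by (simp add: frac_def)
qed

text \<open>Along a periodic orbit the deviation of \<open>F\<^sup>n x\<close> from the linear growth \<open>x + n p / k\<close> is a periodic
  function of \<open>n\<close>, hence bounded.\<close>

lemma periodic_imp_rotation_number_rational:
  assumes lift: "circle_lift f F" and mono: "strict_mono F" and deg: "\<And>t. F (t + 1) = F t + 1"
    and k: "1 \<le> k" and per: "(F ^^ k) x = x + of_int p"
  shows "rotation_number f \<in> \<rat>"
proof -
  define e where "e n = (F ^^ n) x - x - real n * (of_int p / real k)" for n
  have e_per: "e (n + k) = e n" for n
  proof -
    have "(F ^^ (n + k)) x = (F ^^ n) x + of_int p"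
      by (simp add: funpow_add per funpow_add_int[of F, OF deg])
    then show ?thesis using k by (simp add: e_def field_simps)
  qed
  have e_mod: "e n = e (n mod k)" for n
  proof (induction n rule: less_induct)
    case (less n)
    show ?case
    proof (cases "n < k")
      case False
      then have "e n = e (n - k)" using e_per[of "n - k"] by simp
      also have "\<dots> = e ((n - k) mod k)" using False k by (intro less) auto
      also have "(n - k) mod k = n mod k" using False by (simp add: le_mod_geq)
      finally show ?thesis .
    qed simp
  qed
  have e_bound: "\<bar>e n\<bar> \<le> (\<Sum>j<k. \<bar>e j\<bar>)" for n
    unfolding e_mod[of n] using k by (intro member_le_sum) auto
  have "(\<lambda>n. e n / real n) \<longlonglongrightarrow> 0"
  proof (rule Lim_null_comparison)
    show "(\<lambda>n. (\<Sum>j<k. \<bar>e j\<bar>) / real n) \<longlonglongrightarrow> 0" by (rule lim_const_over_n)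
    show "\<forall>\<^sub>F n in sequentially. norm (e n / real n) \<le> (\<Sum>j<k. \<bar>e j\<bar>) / real n"
      using e_bound by (intro always_eventually allI) (simp add: abs_divide divide_right_mono)
  qed
  from tendsto_add[OF this tendsto_const[of "of_int p / real k"]]
  have "(\<lambda>n. e n / real n + of_int p / real k) \<longlonglongrightarrow> of_int p / real k" by simp
  moreover have "\<forall>\<^sub>F n in sequentially. e n / real n + of_int p / real k = ((F ^^ n) x - x) / real n"
    by (rule eventually_mono[OF eventually_gt_at_top[of 0]]) (use k in \<open>simp add: e_def field_simps\<close>)
  ultimately have "(\<lambda>n. ((F ^^ n) x - x) / real n) \<longlonglongrightarrow> of_int p / real k"
    by (rule Lim_transform_eventually)
  from rotation_number_eq[OF lift mono deg this]
  show ?thesis by (simp add: frac_def)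
qed


section \<open>Measure-preserving maps\<close>

text \<open>The maximal ergodic theorem, used in contrapositive form: a function with positive mean has a
  non-null set of points along whose orbits all its partial sums are non-negative. Such one-sided
  bounds at every time are what the contraction arguments below need, and they are stronger in
  this respect than convergence of averages. The argument is Garsia's.\<close>

lemma maximal_ergodic:
  fixes \<phi> :: "'a \<Rightarrow> real"
  assumes T [measurable]: "T \<in> measurable M M" and inv: "distr M M T = M"
    and int: "integrable M \<phi>"
    and neg: "AE x in M. \<exists>n. (\<Sum>i<n. \<phi> ((T ^^ i) x)) < 0"
  shows "(\<integral>x. \<phi> x \<partial>M) \<le> 0"
proof -
  have [measurable]: "\<phi> \<in> borel_measurable M" using int by auto
  have int_T: "integrable M (\<lambda>x. u (T x))" "(\<integral>x. u (T x) \<partial>M) = (\<integral>x. u x \<partial>M)"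
    if "integrable M u" for u :: "'a \<Rightarrow> real"
    using integrable_distr[OF T, of u] integral_distr[OF T, of u] inv that by auto
  \<comment> \<open>\<open>h n\<close> is the maximum of 0 and of the first \<open>n\<close> partial sums of \<open>- \<phi>\<close>.\<close>
  define h where "h = rec_nat (\<lambda>x. 0) (\<lambda>_ u x. max 0 (u (T x) - \<phi> x))"
  have h0: "h 0 x = 0" and hS: "h (Suc n) x = max 0 (h n (T x) - \<phi> x)" for n x
    by (simp_all add: h_def)
  have h_nonneg: "0 \<le> h n x" for n x by (cases n) (auto simp: h0 hS)
  have h_mono: "h n x \<le> h (Suc n) x" for n x
  proof (induction n arbitrary: x)
    case (Suc n)
    show ?case using Suc[of "T x"] by (simp add: hS[of n] hS[of "Suc n"] max_def)
  qed (use h_nonneg in \<open>simp add: h0\<close>)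
  have h_sum: "- (\<Sum>i<n. \<phi> ((T ^^ i) x)) \<le> h n x" for n x
  proof (induction n arbitrary: x)
    case (Suc n)
    have "(\<Sum>i<Suc n. \<phi> ((T ^^ i) x)) = \<phi> x + (\<Sum>i<n. \<phi> ((T ^^ i) (T x)))"
      unfolding sum.lessThan_Suc_shift by (simp add: funpow_swap1)
    then show ?case using Suc[of "T x"] by (simp add: hS)
  qed (simp add: h0)
  have h_int: "integrable M (h n)" for n
  proof (induction n)
    case 0 show ?case using h0 by (simp add: fun_eq_iff cong: Bochner_Integration.integrable_cong)
  next
    case (Suc n)
    have "integrable M (\<lambda>x. max 0 (h n (T x) - \<phi> x))"
      using int_T(1)[OF Suc] int by (intro integrable_max) auto
    then show ?case using hS[of n] by (simp cong: Bochner_Integration.integrable_cong)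
  qed
  have [measurable]: "h n \<in> borel_measurable M" for n using h_int by auto
  \<comment> \<open>Where \<open>h (n+1)\<close> is positive, \<open>- \<phi> = h (n+1) - h n \<circ> T\<close>; elsewhere the right-hand side is
    at most 0. Its mean is non-negative by invariance, since \<open>h\<close> increases with \<open>n\<close>.\<close>
  define w where "w n x = (if h (Suc n) x > 0 then - \<phi> x else 0)" for n x
  have w_int: "integrable M (w n)" for n
  proof (rule Bochner_Integration.integrable_bound[OF int])
    show "w n \<in> borel_measurable M" unfolding w_def by measurable
  qed (auto simp: w_def)
  have w_nonneg: "0 \<le> (\<integral>x. w n x \<partial>M)" for n
  proof -
    have "(\<integral>x. h (Suc n) x - h n (T x) \<partial>M) \<le> (\<integral>x. w n x \<partial>M)"
    proof (rule integral_mono)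
      show "h (Suc n) x - h n (T x) \<le> w n x" for x
        using h_nonneg[of n "T x"] by (auto simp: w_def hS)
    qed (use h_int int_T w_int in auto)
    moreover have "(\<integral>x. h (Suc n) x - h n (T x) \<partial>M) = (\<integral>x. h (Suc n) x \<partial>M) - (\<integral>x. h n x \<partial>M)"
      using h_int int_T by simp
    moreover have "(\<integral>x. h n x \<partial>M) \<le> (\<integral>x. h (Suc n) x \<partial>M)"
      using h_int h_mono by (intro integral_mono) auto
    ultimately show ?thesis by linarith
  qed
  have "(\<lambda>n. \<integral>x. w n x \<partial>M) \<longlonglongrightarrow> (\<integral>x. - \<phi> x \<partial>M)"
  proof (rule integral_dominated_convergence[where w = "\<lambda>x. \<bar>\<phi> x\<bar>"])
    show "AE x in M. (\<lambda>n. w n x) \<longlonglongrightarrow> - \<phi> x"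
      using neg
    proof eventually_elim
      case (elim x)
      then obtain n where "(\<Sum>i<n. \<phi> ((T ^^ i) x)) < 0" by blast
      then have "0 < h n x" using h_sum[where n = n and x = x] by linarith
      then have "w m x = - \<phi> x" if "n \<le> m" for m
      proof -
        have "h n x \<le> h (Suc m) x"
          by (rule lift_Suc_mono_le[of "\<lambda>n. h n x"]) (use h_mono that in auto)
        then show ?thesis using \<open>0 < h n x\<close> by (simp add: w_def)
      qed
      then show ?case
        by (intro tendsto_eventually) (auto simp: eventually_sequentially)
    qed
    show "AE x in M. norm (w n x) \<le> \<bar>\<phi> x\<bar>" for n by (auto simp: w_def)
    show "w n \<in> borel_measurable M" for n using w_int by auto
  qed (use int in auto)
  then have "0 \<le> (\<integral>x. - \<phi> x \<partial>M)" by (rule LIMSEQ_le_const) (use w_nonneg in auto)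
  then show ?thesis by simp
qed

lemma distr_funpow:
  assumes T [measurable]: "T \<in> measurable M M" and inv: "distr M M T = M"
  shows "distr M M (T ^^ i) = M"
proof (induction i)
  case 0 show ?case by (simp add: distr_id[unfolded id_def] id_def)
next
  case (Suc i)
  have [measurable]: "T ^^ i \<in> measurable M M" by (rule measurable_compose_n[OF T])
  have "distr M M (T ^^ Suc i) = distr (distr M M (T ^^ i)) M T"
    by (simp add: distr_distr)
  then show ?case unfolding Suc inv .
qed

text \<open>Without a return the preimages of \<open>A\<close> would be disjoint sets of the same positive measure.\<close>

lemma (in prob_space) poincare_recurrence:
  assumes T [measurable]: "T \<in> measurable M M" and inv: "distr M M T = M"
    and A [measurable]: "A \<in> sets M" and pos: "0 < prob A"
  shows "\<exists>x\<in>A. \<exists>k\<ge>1. (T ^^ k) x \<in> A"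
proof (rule ccontr)
  assume "\<not> ?thesis"
  then have no_return: "(T ^^ k) x \<notin> A" if "x \<in> A" "1 \<le> k" for x k using that by blast
  define B where "B i = (T ^^ i) -` A \<inter> space M" for i
  have meas [measurable]: "T ^^ i \<in> measurable M M" for i by (rule measurable_compose_n[OF T])
  have "prob (B i) = prob A" for i
    using measure_distr[OF meas[of i] A] distr_funpow[OF T inv, of i] by (simp add: B_def)
  moreover have "disjoint_family B"
  proof -
    have "B i \<inter> B j = {}" if "i < j" for i j
    proof -
      have "(T ^^ j) x = (T ^^ (j - i)) ((T ^^ i) x)" for x
        using that by (simp flip: funpow_add[THEN fun_cong, unfolded o_def])
      then show ?thesis using no_return[of _ "j - i"] that by (force simp: B_def)
    qed
    then show ?thesis unfolding disjoint_family_on_def by (metis Int_commute linorder_neqE_nat)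
  qed
  moreover have "B i \<in> sets M" for i unfolding B_def by measurable
  ultimately have "prob (\<Union>i<n. B i) = real n * prob A" for n
    by (subst finite_measure_finite_Union) (auto simp: disjoint_family_on_def)
  then have bound: "real n * prob A \<le> 1" for n using prob_le_1 by metis
  obtain n where "1 < real n * prob A" using reals_Archimedean3[OF pos] by blast
  then show False using bound[of n] by simp
qed

text \<open>The deep negative values of an integrable function contribute little to its mean. The shift \<open>K\<close>
  will cut off the visits of an orbit very close to the critical points.\<close>

lemma small_tail_integral:
  fixes u :: "'a \<Rightarrow> real"
  assumes u: "integrable M u" and \<epsilon>: "0 < \<epsilon>"
  obtains K where "integrable M (\<lambda>z. min (u z + K) 0)" "- \<epsilon> < (\<integral>z. min (u z + K) 0 \<partial>M)"
proof -
  have [measurable]: "u \<in> borel_measurable M" using u by auto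
  have int: "integrable M (\<lambda>z. min (u z + real K) 0)" for K :: nat
    by (rule Bochner_Integration.integrable_bound[OF u]) (auto simp: min_def)
  have "(\<lambda>K. \<integral>z. min (u z + real K) 0 \<partial>M) \<longlonglongrightarrow> (\<integral>z. 0 \<partial>M)"
  proof (rule integral_dominated_convergence[where w = "\<lambda>z. \<bar>u z\<bar>"])
    show "AE z in M. (\<lambda>K. min (u z + real K) 0) \<longlonglongrightarrow> 0"
    proof (rule AE_I2)
      fix z
      obtain N :: nat where N: "- u z \<le> real N" using real_arch_simple by blast
      have "\<forall>\<^sub>F K in sequentially. min (u z + real K) 0 = 0"
        by (rule eventually_sequentiallyI[of N]) (use N in \<open>auto simp: min_def\<close>)
      then show "(\<lambda>K. min (u z + real K) 0) \<longlonglongrightarrow> 0" by (rule tendsto_eventually)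
    qed
  qed (use u in \<open>auto simp: min_def\<close>)
  then have "\<forall>\<^sub>F K in sequentially. - \<epsilon> < (\<integral>z. min (u z + real K) 0 \<partial>M)"
    using \<epsilon> by (intro order_tendstoD) auto
  then obtain K where "- \<epsilon> < (\<integral>z. min (u z + real K) 0 \<partial>M)"
    using eventually_happens' sequentially_bot by blast
  then show ?thesis using that[of "real K"] int by blast
qed

section \<open>Circle maps without periodic points\<close>

text \<open>The setting of the two exponent estimates: a circle homeomorphism \<open>f\<close> with inverse \<open>g\<close> and a lift
  \<open>F\<close> with Lipschitz derivative, none of whose points is periodic. The derivative may vanish, so
  the inverse need not be Lipschitz.\<close>

locale aperiodic_circle_map =
  fixes f g :: "complex \<Rightarrow> complex" and F :: "real \<Rightarrow> real" and L :: real
  assumes lift: "circle_lift f F"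
    and homeo: "homeomorphism circle circle f g"
    and mono: "strict_mono F"
    and diff: "F differentiable (at t)"
    and lipschitz: "\<bar>deriv F t - deriv F u\<bar> \<le> L * \<bar>t - u\<bar>"
    and L_pos: "0 < L"
    and aperiodic: "1 \<le> k \<Longrightarrow> (F ^^ k) t \<noteq> t + of_int p"
begin

abbreviation D :: "complex \<Rightarrow> real" where "D \<equiv> circle_deriv f"

definition G :: "real \<Rightarrow> real" where "G = inv F"

lemma DF: "(F has_real_derivative deriv F t) (at t)"
  using diff by (simp add: DERIV_deriv_iff_real_differentiable)

lemma D_proj: "D (circle_proj t) = deriv F t"
  using circle_deriv_eq[OF lift DF] .

lemma F_deg: "F (t + 1) = F t + 1"
  using circle_homeo_lift_degree_one[OF lift _ mono] homeo
  by (metis homeomorphism_apply1 inj_on_inverseI)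

lemma F_add_int: "F (t + of_int p) = F t + of_int p"
  using add_int_equivariant[of F 1, simplified, OF F_deg] by simp

lemma Fn_add_int: "(F ^^ n) (t + of_int p) = (F ^^ n) t + of_int p"
  by (rule funpow_add_int) (rule F_deg)

lemma F_cont: "continuous_on A F"
  using lift unfolding circle_lift_def by (meson continuous_on_subset top_greatest)

lemma deriv_cont: "continuous_on A (deriv F)"
proof (rule continuous_on_subset[OF lipschitz_on_continuous_on])
  show "L-lipschitz_on UNIV (deriv F)"
    using lipschitz L_pos by (intro lipschitz_onI) (auto simp: dist_real_def)
qed simp

lemma D_cont: "continuous_on circle D"
  by (rule continuous_on_circleI) (simp add: D_proj deriv_cont)

lemma deriv_nonneg: "0 \<le> deriv F t"
  using mono_on_imp_deriv_nonneg[of UNIV F, OF _ DF] strict_mono_mono[OF mono] by simp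

lemma D_nonneg: "z \<in> circle \<Longrightarrow> 0 \<le> D z"
  using circle_proj_surj D_proj deriv_nonneg by metis

lemma D_bounded: obtains B where "1 \<le> B" "\<And>z. z \<in> circle \<Longrightarrow> D z \<le> B"
proof -
  have "bounded (D ` circle)"
    using compact_continuous_image[OF D_cont] compact_imp_bounded by auto
  then obtain B where "\<And>z. z \<in> circle \<Longrightarrow> \<bar>D z\<bar> \<le> B" unfolding bounded_iff by fastforce
  then show ?thesis using that[of "max 1 B"] by fastforce
qed

lemma F_surj: "surj F"
  unfolding surj_def
proof
  fix y
  define n where "n = \<lceil>\<bar>y - F 0\<bar>\<rceil>"
  have n: "\<bar>y - F 0\<bar> \<le> of_int n" by (simp add: n_def)
  have "F (of_int (- n)) = F 0 + of_int (- n)" "F (of_int n) = F 0 + of_int n"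
    using F_add_int[of 0 n] F_add_int[of 0 "- n"] by simp_all
  then have "F (of_int (- n)) \<le> y" "y \<le> F (of_int n)" using n by auto
  moreover have "real_of_int (- n) \<le> of_int n" using n by simp
  ultimately show "\<exists>x. y = F x" using IVT'[of F "of_int (- n)" y "of_int n"] F_cont by blast
qed

lemma F_inj: "inj F" using mono by (rule strict_mono_imp_inj_on)

lemma F_G [simp]: "F (G t) = t" unfolding G_def by (rule surj_f_inv_f[OF F_surj])

lemma Fn_Gn [simp]: "(F ^^ n) ((G ^^ n) t) = t"
  by (induction n arbitrary: t) (simp_all add: funpow_swap1[of G])

lemma Fn_inj: "inj (F ^^ n)" using F_inj by (rule inj_fn)

lemma G_le_iff: "G s \<le> t \<longleftrightarrow> s \<le> F t"
  using strict_mono_less_eq[OF mono, of "G s" t] by simp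

lemma le_G_iff: "t \<le> G s \<longleftrightarrow> F t \<le> s"
  using strict_mono_less_eq[OF mono, of t "G s"] by simp

lemma circle_proj_G: "circle_proj (G t) = g (circle_proj t)"
  using circle_lift_proj[OF lift, of "G t"] homeo
  by (metis F_G circle_proj_in_circle homeomorphism_apply1)

lemma circle_proj_Gn: "circle_proj ((G ^^ n) t) = (g ^^ n) (circle_proj t)"
  by (induction n) (simp_all add: circle_proj_G)

lemma circle_proj_Fn: "circle_proj ((F ^^ n) t) = (f ^^ n) (circle_proj t)"
  using circle_lift_proj[OF circle_lift_funpow[OF lift]] by simp

subsection \<open>No interval around a recurrent point contracts\<close>

text \<open>The displacement of \<open>F\<^sup>k - p\<close> is continuous, periodic and without zeros.\<close>

lemma displacement_bounded_below:
  assumes "1 \<le> k"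
  obtains \<epsilon> where "0 < \<epsilon>" "\<And>u. \<epsilon> \<le> \<bar>(F ^^ k) u - of_int p - u\<bar>"
proof -
  define \<Delta> where "\<Delta> u = \<bar>(F ^^ k) u - of_int p - u\<bar>" for u
  have "continuous_on {0..1} (F ^^ k)"
    using circle_lift_funpow[OF lift, of k] unfolding circle_lift_def
    by (meson continuous_on_subset top_greatest)
  then have "continuous_on {0..1} \<Delta>" unfolding \<Delta>_def by (intro continuous_intros)
  from continuous_attains_inf[OF compact_Icc _ this]
  obtain v where v: "v \<in> {0..1}" "\<And>u. u \<in> {0..1} \<Longrightarrow> \<Delta> v \<le> \<Delta> u" by fastforce
  have "0 < \<Delta> v" using aperiodic[OF assms, of v p] by (simp add: \<Delta>_def)
  moreover have "\<Delta> v \<le> \<Delta> u" for u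
  proof -
    have "\<Delta> (frac u + of_int \<lfloor>u\<rfloor>) = \<Delta> (frac u)"
      unfolding \<Delta>_def Fn_add_int by simp
    moreover have "frac u + of_int \<lfloor>u\<rfloor> = u" by (simp add: frac_def)
    moreover have "frac u \<in> {0..1}" using frac_lt_1[of u] by auto
    ultimately show ?thesis using v(2) by metis
  qed
  ultimately show ?thesis using that[of "\<Delta> v"] by (simp add: \<Delta>_def)
qed

text \<open>If maps \<open>H n\<close> commuting with \<open>F\<^sup>k - p\<close> bring \<open>x\<close> and its image under \<open>F\<^sup>k - p\<close> together, then
  \<open>F\<^sup>k - p\<close> displaces the points \<open>H n x\<close> by arbitrarily little. Both the forward and the backward iterates of \<open>F\<close> are such families.\<close>

lemma no_asymptotic_translates:
  assumes k: "1 \<le> k"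
    and comm: "\<And>n. H n ((F ^^ k) x - of_int p) = (F ^^ k) (H n x) - of_int p"
    and lim: "(\<lambda>n. H n ((F ^^ k) x - of_int p) - H n x) \<longlonglongrightarrow> 0"
  shows False
proof -
  obtain \<epsilon> where \<epsilon>: "0 < \<epsilon>" "\<And>u. \<epsilon> \<le> \<bar>(F ^^ k) u - of_int p - u\<bar>"
    using displacement_bounded_below[OF k] by metis
  from LIMSEQ_D[OF lim \<epsilon>(1)] obtain n where "\<bar>H n ((F ^^ k) x - of_int p) - H n x\<bar> < \<epsilon>"
    by auto
  then show False using \<epsilon>(2)[of "H n x"] by (simp add: comm)
qed

lemma no_forward_contraction:
  assumes k: "1 \<le> k" and near: "\<bar>(F ^^ k) x - of_int p - x\<bar> < r"
    and lim: "\<And>y. \<bar>y - x\<bar> < r \<Longrightarrow> (\<lambda>n. (F ^^ n) y - (F ^^ n) x) \<longlonglongrightarrow> 0"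
  shows False
proof (rule no_asymptotic_translates[OF k])
  show "(F ^^ n) ((F ^^ k) x - of_int p) = (F ^^ k) ((F ^^ n) x) - of_int p" for n
    using Fn_add_int[of n "(F ^^ k) x" "- p"] funpow_add[of n k F] funpow_add[of k n F]
    by (simp add: add.commute o_def fun_eq_iff)
qed (rule lim[OF near])

lemma no_backward_contraction:
  assumes k: "1 \<le> k" and near: "\<bar>(F ^^ k) x - of_int p - x\<bar> < r"
    and lim: "\<And>y. \<bar>y - x\<bar> < r \<Longrightarrow> (\<lambda>n. (G ^^ n) y - (G ^^ n) x) \<longlonglongrightarrow> 0"
  shows False
proof (rule no_asymptotic_translates[OF k])
  fix n
  have "(F ^^ n) ((F ^^ k) ((G ^^ n) x) - of_int p) = (F ^^ k) ((F ^^ n) ((G ^^ n) x)) - of_int p"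
    using Fn_add_int[of n "(F ^^ k) ((G ^^ n) x)" "- p"] funpow_add[of n k F] funpow_add[of k n F]
    by (simp add: add.commute o_def fun_eq_iff del: Fn_Gn)
  then have "(F ^^ n) ((F ^^ k) ((G ^^ n) x) - of_int p) = (F ^^ n) ((G ^^ n) ((F ^^ k) x - of_int p))"
    by simp
  then show "(G ^^ n) ((F ^^ k) x - of_int p) = (F ^^ k) ((G ^^ n) x) - of_int p"
    using Fn_inj by (metis injD)
qed (rule lim[OF near])

subsection \<open>Invariant measures\<close>

context
  fixes \<mu> :: "complex measure"
  assumes invariant: "invariant_borel_prob f \<mu>"
begin

interpretation prob_space \<mu> using invariant by (simp add: invariant_borel_prob_def)

lemma sets_mu [measurable_cong]: "sets \<mu> = sets (restrict_space borel circle)"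
  using invariant by (simp add: invariant_borel_prob_def)

lemma space_mu: "space \<mu> = circle"
  using sets_eq_imp_space_eq[OF sets_mu] by (simp add: space_restrict_space)

lemma distr_f: "distr \<mu> \<mu> f = \<mu>"
  using invariant by (simp add: invariant_borel_prob_def)

lemma measurable_circle_real:
  fixes u :: "complex \<Rightarrow> real"
  shows "continuous_on circle u \<Longrightarrow> u \<in> borel_measurable \<mu>"
  using borel_measurable_continuous_on_restrict measurable_cong_sets[OF sets_mu refl] by blast

lemma measurable_circle_map:
  assumes "continuous_on circle u" "u ` circle \<subseteq> circle"
  shows "u \<in> measurable \<mu> \<mu>"
proof -
  have "u \<in> measurable (restrict_space borel circle) (restrict_space borel circle)"
    using assms borel_measurable_continuous_on_restrict[of circle u]
    by (intro measurable_restrict_space2) (auto simp: space_restrict_space)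
  then show ?thesis using measurable_cong_sets[OF sets_mu sets_mu] by blast
qed

lemma f_meas [measurable]: "f \<in> measurable \<mu> \<mu>"
  using homeo by (intro measurable_circle_map) (auto simp: homeomorphism_def)

lemma g_meas [measurable]: "g \<in> measurable \<mu> \<mu>"
  using homeo by (intro measurable_circle_map) (auto simp: homeomorphism_def)

lemma D_meas [measurable]: "D \<in> borel_measurable \<mu>"
  by (intro measurable_circle_real D_cont)

lemma distr_g: "distr \<mu> \<mu> g = \<mu>"
proof -
  have "distr \<mu> \<mu> g = distr (distr \<mu> \<mu> f) \<mu> g" by (simp add: distr_f)
  also have "\<dots> = distr \<mu> \<mu> (g \<circ> f)" by (simp add: distr_distr)
  also have "\<dots> = distr \<mu> \<mu> (\<lambda>z. z)"
    by (rule distr_cong) (use homeo in \<open>auto simp: space_mu homeomorphism_def\<close>)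
  finally show ?thesis by (simp add: distr_id[unfolded id_def])
qed

text \<open>Recurrence in a set cut into short arcs gives a point of the set that returns close to itself,
  as \<open>no_forward_contraction\<close> and \<open>no_backward_contraction\<close> require.\<close>

lemma close_return:
  assumes E [measurable]: "E \<in> sets \<mu>" and nonnull: "\<not> (AE z in \<mu>. z \<notin> E)" and r: "0 < r"
  obtains x k p where "circle_proj x \<in> E" "1 \<le> k" "\<bar>(F ^^ k) x - of_int p - x\<bar> < r"
proof -
  obtain N :: nat where N: "N > 0" "1 / real N < r"
    using reals_Archimedean[OF r] by (metis inverse_eq_divide zero_less_Suc)
  define I where "I j = circle_proj ` {real j / N..(real j + 1) / N}" for j :: nat
  have I [measurable]: "I j \<in> sets \<mu>" for j
  proof -
    have "closed (I j)" unfolding I_def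
      by (intro compact_imp_closed compact_continuous_image continuous_intros compact_Icc)
    moreover have "I j \<subseteq> circle" unfolding I_def using circle_proj_in_circle by blast
    ultimately show ?thesis
      unfolding sets_mu by (auto simp: sets_restrict_space_iff)
  qed
  have cover: "\<exists>j. z \<in> I j" if "z \<in> circle" for z
  proof -
    obtain t where t: "t \<in> {0..1}" "circle_proj t = z" using circle_proj_surj \<open>z \<in> circle\<close> by blast
    define j where "j = nat \<lfloor>t * N\<rfloor>"
    have "real j = of_int \<lfloor>t * N\<rfloor>" using t by (simp add: j_def)
    then have "real j \<le> t * N" "t * N \<le> real j + 1" by linarith+
    then have "t \<in> {real j / N..(real j + 1) / N}" using N by (simp add: field_simps)
    then show ?thesis using t(2) unfolding I_def by blast
  qed
  have "\<exists>j. prob (E \<inter> I j) > 0"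
  proof (rule ccontr)
    assume "\<not> ?thesis"
    then have "prob (E \<inter> I j) = 0" for j using measure_nonneg[of \<mu>] by (metis less_eq_real_def)
    then have "AE z in \<mu>. z \<notin> E \<inter> I j" for j
      by (subst (asm) prob_eq_0) auto
    then have "AE z in \<mu>. \<forall>j. z \<notin> E \<inter> I j" unfolding AE_all_countable by blast
    then have "AE z in \<mu>. z \<notin> E"
      using AE_space by eventually_elim (use cover space_mu in auto)
    with nonnull show False by simp
  qed
  then obtain j where "prob (E \<inter> I j) > 0" by blast
  from poincare_recurrence[OF f_meas distr_f _ this]
  obtain z k where zk: "z \<in> E" "z \<in> I j" "1 \<le> k" "(f ^^ k) z \<in> I j" by auto
  obtain x y where x: "z = circle_proj x" "x \<in> {real j / N..(real j + 1) / N}"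
    and y: "(f ^^ k) z = circle_proj y" "y \<in> {real j / N..(real j + 1) / N}"
    using zk unfolding I_def by blast
  have "circle_proj ((F ^^ k) x) = circle_proj y"
    using x y circle_proj_Fn by simp
  then obtain p :: int where "(F ^^ k) x = y + of_int p" by (auto simp: circle_proj_eq_iff)
  moreover have "\<bar>y - x\<bar> \<le> 1 / N"
    using x(2) y(2) by (simp add: add_divide_distrib abs_le_iff)
  ultimately show ?thesis using that[of x k p] zk x N by auto
qed

end

subsection \<open>The exponent is non-negative\<close>

lemma F_diff_le:
  assumes "\<And>u. \<bar>u - v\<bar> \<le> \<bar>w - v\<bar> \<Longrightarrow> deriv F u \<le> K"
  shows "\<bar>F w - F v\<bar> \<le> K * \<bar>w - v\<bar>"
proof -
  have "norm (F w - F v) \<le> K * norm (w - v)"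
  proof (rule field_differentiable_bound[where S = "closed_segment v w" and f' = "deriv F"])
    show "(F has_real_derivative deriv F z) (at z within closed_segment v w)" for z
      using DF by (rule DERIV_subset) simp
    show "norm (deriv F z) \<le> K" if "z \<in> closed_segment v w" for z
    proof -
      have "\<bar>z - v\<bar> \<le> \<bar>w - v\<bar>" using that by (auto simp: closed_segment_eq_real_ivl split: if_splits)
      then show ?thesis using assms[of z] deriv_nonneg[of z] by simp
    qed
  qed auto
  then show ?thesis by simp
qed

lemma F_diff_ge:
  assumes "v < w" "\<And>u. v \<le> u \<Longrightarrow> u \<le> w \<Longrightarrow> K \<le> deriv F u"
  shows "K * (w - v) \<le> F w - F v"
proof -
  obtain z where "v < z" "z < w" "F w - F v = (w - v) * deriv F z"
    using MVT2[OF assms(1) DF] by blast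
  then show ?thesis using assms by (simp add: mult.commute mult_right_mono)
qed

text \<open>Replacing \<open>F'\<close> by the larger \<open>max F' s\<close> makes its logarithm uniformly continuous: on
  intervals of length at most \<open>r\<close> the derivative exceeds the truncated value at the centre by a
  factor of at most \<open>exp \<delta>\<close>. As long as the sums decrease at rate \<open>2 \<delta>\<close>, the images of the interval
  shrink at rate \<open>\<delta>\<close>, so they keep the length for which the comparison is valid.\<close>

lemma truncated_log_orbit_contracts:
  assumes s: "0 < s" and \<delta>: "0 < \<delta>" and r: "L * r \<le> s * (exp \<delta> - 1)"
    and sum: "\<And>n. (\<Sum>i<n. ln (max (deriv F ((F ^^ i) x)) s)) \<le> - (2 * \<delta> * real n)"
    and y: "\<bar>y - x\<bar> \<le> r"
  shows "(\<lambda>n. (F ^^ n) y - (F ^^ n) x) \<longlonglongrightarrow> 0"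
proof -
  define a where "a i = max (deriv F ((F ^^ i) x)) s" for i
  have a: "s \<le> a i" "deriv F ((F ^^ i) x) \<le> a i" for i by (simp_all add: a_def)
  have claim: "\<bar>(F ^^ n) y - (F ^^ n) x\<bar> \<le> r * exp ((\<Sum>i<n. ln (a i)) + \<delta> * real n)"
    and bound: "exp ((\<Sum>i<n. ln (a i)) + \<delta> * real n) \<le> exp (- (\<delta> * real n))" for n
  proof -
    have r0: "0 \<le> r" using y by linarith
    show bound: "exp ((\<Sum>i<n. ln (a i)) + \<delta> * real n) \<le> exp (- (\<delta> * real n))" for n
      using sum[of n] by (simp add: a_def)
    show "\<bar>(F ^^ n) y - (F ^^ n) x\<bar> \<le> r * exp ((\<Sum>i<n. ln (a i)) + \<delta> * real n)"
    proof (induction n)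
      case (Suc n)
      let ?v = "(F ^^ n) x" and ?w = "(F ^^ n) y"
      have "exp ((\<Sum>i<n. ln (a i)) + \<delta> * real n) \<le> 1"
        using order_trans[OF bound[of n], of 1] \<delta> by simp
      then have close: "\<bar>?w - ?v\<bar> \<le> r"
        using Suc r0 mult_left_mono[of "exp ((\<Sum>i<n. ln (a i)) + \<delta> * real n)" 1 r] by simp
      have "\<bar>F ?w - F ?v\<bar> \<le> (a n * exp \<delta>) * \<bar>?w - ?v\<bar>"
      proof (rule F_diff_le)
        fix u assume "\<bar>u - ?v\<bar> \<le> \<bar>?w - ?v\<bar>"
        then have "L * \<bar>u - ?v\<bar> \<le> L * r" using close L_pos by (intro mult_left_mono) auto
        then have "deriv F u \<le> deriv F ?v + s * (exp \<delta> - 1)"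
          using lipschitz[of u ?v] r by linarith
        also have "\<dots> \<le> a n + a n * (exp \<delta> - 1)"
          using a[of n] \<delta> by (intro add_mono mult_right_mono) auto
        finally show "deriv F u \<le> a n * exp \<delta>" by (simp add: algebra_simps)
      qed
      also have "\<dots> \<le> (a n * exp \<delta>) * (r * exp ((\<Sum>i<n. ln (a i)) + \<delta> * real n))"
        using Suc a[of n] s by (intro mult_left_mono) auto
      also have "\<dots> = r * exp ((\<Sum>i<Suc n. ln (a i)) + \<delta> * real (Suc n))"
        using a[of n] s by (simp add: exp_add distrib_left)
      finally show ?case by simp
    qed (use y in simp)
  qed
  have lim: "(\<lambda>n. r * exp (- (\<delta> * real n))) \<longlonglongrightarrow> 0"
    using \<delta> by real_asymp
  have le: "norm ((F ^^ n) y - (F ^^ n) x) \<le> r * exp (- (\<delta> * real n))" for n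
    using claim[of n] mult_left_mono[OF bound[of n], of r] order_trans[OF abs_ge_zero y] by simp
  show ?thesis by (rule Lim_null_comparison[OF always_eventually lim]) (intro allI le)
qed

lemma ln_max_cont: "0 < s \<Longrightarrow> continuous_on circle (\<lambda>z. ln (max (D z) s))"
  using D_cont by (intro continuous_intros) auto

lemma ln_max_bounded:
  assumes "0 < s"
  obtains B where "\<And>z. z \<in> circle \<Longrightarrow> \<bar>ln (max (D z) s)\<bar> \<le> B"
proof -
  have "bounded ((\<lambda>z. ln (max (D z) s)) ` circle)"
    using compact_continuous_image[OF ln_max_cont[OF assms]] compact_imp_bounded by auto
  then show ?thesis using that unfolding bounded_iff by fastforce
qed

lemma integrable_ln_max:
  assumes "invariant_borel_prob f \<mu>" "0 < s"
  shows "integrable \<mu> (\<lambda>z. ln (max (D z) s))"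
proof -
  interpret prob_space \<mu> using assms by (simp add: invariant_borel_prob_def)
  obtain B where "\<And>z. z \<in> circle \<Longrightarrow> \<bar>ln (max (D z) s)\<bar> \<le> B" using ln_max_bounded[OF assms(2)] by metis
  then show ?thesis
    using measurable_circle_real[OF assms(1) ln_max_cont[OF assms(2)]]
    by (intro integrable_const_bound[where B = B]) (auto simp: space_mu[OF assms(1)] intro!: AE_I2)
qed

text \<open>A negative mean would give a non-null set of points along whose forward orbits the truncated
  logarithms sum to at most \<open>- 2 \<delta> n\<close> at every time \<open>n\<close>. One of them is recurrent, and an interval of
  definite size around it contracts.\<close>

lemma integral_ln_max_nonneg:
  assumes inv: "invariant_borel_prob f \<mu>" and s: "0 < s"
  shows "0 \<le> (\<integral>z. ln (max (D z) s) \<partial>\<mu>)"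
proof (rule ccontr)
  interpret prob_space \<mu> using inv by (simp add: invariant_borel_prob_def)
  note [measurable] = f_meas[OF inv] D_meas[OF inv]
  define m where "m = - (\<integral>z. ln (max (D z) s) \<partial>\<mu>)"
  define \<delta> where "\<delta> = m / 4"
  define \<phi> where "\<phi> z = - ln (max (D z) s) - 2 * \<delta>" for z
  define r where "r = s * (exp \<delta> - 1) / L"
  assume "\<not> ?thesis"
  then have "0 < m" by (simp add: m_def)
  then have \<delta>: "0 < \<delta>" and r: "0 < r" using s L_pos by (simp_all add: \<delta>_def r_def)
  have \<phi>_int: "integrable \<mu> \<phi>" unfolding \<phi>_def using integrable_ln_max[OF inv s] by simp
  then have [measurable]: "\<phi> \<in> borel_measurable \<mu>" by auto
  have [measurable]: "f ^^ i \<in> measurable \<mu> \<mu>" for i by (rule measurable_compose_n) measurable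
  have "(\<integral>z. \<phi> z \<partial>\<mu>) = m - 2 * \<delta>"
    unfolding \<phi>_def using integrable_ln_max[OF inv s] by (simp add: m_def prob_space)
  then have "0 < (\<integral>z. \<phi> z \<partial>\<mu>)" using \<open>0 < m\<close> by (simp add: \<delta>_def)
  then have nonnull: "\<not> (AE z in \<mu>. \<exists>n. (\<Sum>i<n. \<phi> ((f ^^ i) z)) < 0)"
    using maximal_ergodic[OF f_meas[OF inv] distr_f[OF inv] \<phi>_int] by fastforce
  define E where "E = {z \<in> space \<mu>. \<forall>n. 0 \<le> (\<Sum>i<n. \<phi> ((f ^^ i) z))}"
  have "E \<in> sets \<mu>" unfolding E_def by measurable
  moreover have "\<not> (AE z in \<mu>. z \<notin> E)"
  proof
    assume "AE z in \<mu>. z \<notin> E"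
    then have "AE z in \<mu>. \<exists>n. (\<Sum>i<n. \<phi> ((f ^^ i) z)) < 0"
      using AE_space by eventually_elim (auto simp: E_def not_le)
    with nonnull show False by blast
  qed
  ultimately obtain x k p where x: "circle_proj x \<in> E" "1 \<le> k" "\<bar>(F ^^ k) x - of_int p - x\<bar> < r"
    using close_return[OF inv _ _ r] by metis
  have sum: "(\<Sum>i<n. ln (max (deriv F ((F ^^ i) x)) s)) \<le> - (2 * \<delta> * real n)" for n
  proof -
    have "0 \<le> (\<Sum>i<n. \<phi> ((f ^^ i) (circle_proj x)))" using x by (simp add: E_def)
    also have "\<dots> = (\<Sum>i<n. - ln (max (deriv F ((F ^^ i) x)) s) - 2 * \<delta>)"
      by (simp add: \<phi>_def D_proj flip: circle_proj_Fn)
    finally show ?thesis by (simp add: sum_subtractf sum_negf algebra_simps)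
  qed
  have "(\<lambda>n. (F ^^ n) y - (F ^^ n) x) \<longlonglongrightarrow> 0" if "\<bar>y - x\<bar> < r" for y
    by (rule truncated_log_orbit_contracts[OF s \<delta> _ sum, of r]) (use that L_pos in \<open>auto simp: r_def\<close>)
  then show False using no_forward_contraction[OF x(2,3)] by blast
qed

text \<open>The truncations decrease to \<open>ln D\<close> while their means stay non-negative. So \<open>D\<close> cannot vanish on
  a set of positive measure, and monotone convergence gives integrability. The third statement passes
  bounds for truncated means to the limit.\<close>

lemma log_deriv_integrable:
  assumes inv: "invariant_borel_prob f \<mu>"
  shows "AE z in \<mu>. 0 < D z" "integrable \<mu> (\<lambda>z. ln (D z))"
    and "(\<lambda>n. \<integral>z. ln (max (D z) (1 / real (Suc n))) \<partial>\<mu>) \<longlonglongrightarrow> (\<integral>z. ln (D z) \<partial>\<mu>)"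
proof -
  interpret prob_space \<mu> using inv by (simp add: invariant_borel_prob_def)
  note [measurable] = D_meas[OF inv]
  obtain B where B: "1 \<le> B" "\<And>z. z \<in> circle \<Longrightarrow> D z \<le> B" using D_bounded by metis
  \<comment> \<open>Turned around so that the sequence is increasing and non-negative.\<close>
  define v where "v n z = ln B - ln (max (D z) (1 / real (Suc n)))" for n z
  have v_int: "integrable \<mu> (v n)" for n
    unfolding v_def using integrable_ln_max[OF inv, of "1 / real (Suc n)"] by simp
  have v_integral: "(\<integral>z. v n z \<partial>\<mu>) = ln B - (\<integral>z. ln (max (D z) (1 / real (Suc n))) \<partial>\<mu>)" for n
    unfolding v_def using integrable_ln_max[OF inv, of "1 / real (Suc n)"] by (simp add: prob_space)
  have v_le: "(\<integral>z. v n z \<partial>\<mu>) \<le> ln B" for n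
    using v_integral[of n] integral_ln_max_nonneg[OF inv, of "1 / real (Suc n)"] by simp
  have v_nonneg: "0 \<le> v n z" if "z \<in> circle" for n z
  proof -
    have "1 / real (Suc n) \<le> B" using B(1) by (rule order_trans[rotated]) simp
    then have "max (D z) (1 / real (Suc n)) \<le> B" using B(2)[OF that] by simp
    moreover have "0 < max (D z) (1 / real (Suc n))" by (simp add: less_max_iff_disj)
    ultimately have "ln (max (D z) (1 / real (Suc n))) \<le> ln B" using B(1) by (subst ln_le_cancel_iff) auto
    then show ?thesis unfolding v_def by simp
  qed
  have v_mono: "v n z \<le> v m z" if "n \<le> m" for n m z
  proof -
    have "1 / real (Suc m) \<le> 1 / real (Suc n)" using that by (simp add: field_simps)
    then have "max (D z) (1 / real (Suc m)) \<le> max (D z) (1 / real (Suc n))" by linarith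
    moreover have "0 < max (D z) (1 / real (Suc m))" by (simp add: less_max_iff_disj)
    ultimately have "ln (max (D z) (1 / real (Suc m))) \<le> ln (max (D z) (1 / real (Suc n)))"
      by (subst ln_le_cancel_iff) linarith+
    then show ?thesis unfolding v_def by simp
  qed
  show pos: "AE z in \<mu>. 0 < D z"
  proof -
    define Z where "Z = {z \<in> space \<mu>. D z = 0}"
    have [measurable]: "Z \<in> sets \<mu>" unfolding Z_def by measurable
    \<comment> \<open>On the zero set \<open>Z\<close> the \<open>n\<close>-th function is at least \<open>ln (n+1)\<close>, yet its mean is bounded.\<close>
    have "ln (real (Suc n)) * prob Z \<le> ln B" for n
    proof -
      have "(\<integral>z. ln (real (Suc n)) * indicator Z z \<partial>\<mu>) \<le> (\<integral>z. v n z \<partial>\<mu>)"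
      proof (rule integral_mono)
        fix z assume z: "z \<in> space \<mu>"
        show "ln (real (Suc n)) * indicator Z z \<le> v n z"
        proof (cases "z \<in> Z")
          case True
          then have "v n z = ln B + ln (real (Suc n))"
            by (simp add: v_def Z_def ln_div)
          then show ?thesis using True B(1) by simp
        qed (use v_nonneg z space_mu[OF inv] in auto)
      qed (use v_int in \<open>auto intro!: integrable_real_indicator simp: emeasure_eq_measure\<close>)
      then show ?thesis using v_le[of n] by simp
    qed
    moreover have "filterlim (\<lambda>n. ln (real (Suc n)) * prob Z) at_top sequentially" if "0 < prob Z"
      using that by real_asymp
    ultimately have "\<not> 0 < prob Z"
      unfolding filterlim_at_top_dense eventually_sequentially using not_le by blast
    then have "prob Z = 0" using measure_nonneg[of \<mu> Z] by simp
    then have "AE z in \<mu>. z \<notin> Z" by (subst (asm) prob_eq_0) auto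
    then show ?thesis using AE_space
      by eventually_elim (use D_nonneg space_mu[OF inv] in \<open>fastforce simp: Z_def\<close>)
  qed
  have "incseq (\<lambda>n. \<integral>z. v n z \<partial>\<mu>)"
    using v_mono v_int by (intro monoI integral_mono) auto
  then obtain l where l: "(\<lambda>n. \<integral>z. v n z \<partial>\<mu>) \<longlonglongrightarrow> l"
    using incseq_convergent[of "\<lambda>n. \<integral>z. v n z \<partial>\<mu>" "ln B"] v_le by metis
  have mono: "AE z in \<mu>. mono (\<lambda>n. v n z)" using v_mono by (intro AE_I2 monoI)
  have nonneg: "AE z in \<mu>. 0 \<le> v n z" for n using v_nonneg space_mu[OF inv] by (intro AE_I2) auto
  have lim: "AE z in \<mu>. (\<lambda>n. v n z) \<longlonglongrightarrow> ln B - ln (D z)"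
    using pos
  proof eventually_elim
    case (elim z)
    have "(\<lambda>n. 1 / real (Suc n)) \<longlonglongrightarrow> 0" by real_asymp
    then have "(\<lambda>n. max (D z) (1 / real (Suc n))) \<longlonglongrightarrow> max (D z) 0"
      by (intro tendsto_intros)
    then show ?case unfolding v_def using elim by (intro tendsto_intros) auto
  qed
  have meas: "(\<lambda>z. ln B - ln (D z)) \<in> borel_measurable \<mu>" by measurable
  note * = integral_monotone_convergence_nonneg[OF v_int mono nonneg lim l meas]
  show int: "integrable \<mu> (\<lambda>z. ln (D z))"
    using Bochner_Integration.integrable_diff[OF integrable_const[of "ln B"] *(1)] by simp
  have "l = ln B - (\<integral>z. ln (D z) \<partial>\<mu>)" using *(2) int by (simp add: prob_space)
  then have "(\<lambda>n. ln B - (\<integral>z. v n z \<partial>\<mu>)) \<longlonglongrightarrow> ln B - (ln B - (\<integral>z. ln (D z) \<partial>\<mu>))"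
    using l by (intro tendsto_intros) auto
  then show "(\<lambda>n. \<integral>z. ln (max (D z) (1 / real (Suc n))) \<partial>\<mu>) \<longlonglongrightarrow> (\<integral>z. ln (D z) \<partial>\<mu>)"
    by (simp add: v_integral)
qed

subsection \<open>The exponent is non-positive\<close>

text \<open>The interval of radius \<open>r\<close> around \<open>x\<close> is pulled back along \<open>x\<^sub>n = G\<^sup>n x\<close>. Its \<open>n\<close>-th preimage stays in the
  ball of radius \<open>R n = r exp (- \<Sum> (ln F'(x\<^sub>i) - \<delta>))\<close>, the sum running over \<open>1 \<le> i \<le> n\<close>, provided that on
  this ball \<open>F'\<close> is at least \<open>exp (- \<delta>) F'(x\<^sub>n)\<close>. As \<open>F'\<close> is Lipschitz, this holds if \<open>R n\<close> is a small
  multiple of \<open>F'(x\<^sub>n)\<close>, which is not automatic when \<open>x\<^sub>n\<close> comes close to a critical point. This is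
  why the hypothesis counts deep values twice: the additional term \<open>min (ln F'(x\<^sub>n) + M) 0\<close> pays
  for the factor \<open>F'(x\<^sub>n)\<close>, up to the constant \<open>exp M\<close>, at whichever time \<open>n\<close> it is needed.\<close>

lemma deep_orbit_backward_contracts:
  assumes \<delta>: "0 < \<delta>" and r: "L * (r * exp M) \<le> 1 - exp (- \<delta>)"
    and pos: "\<And>i. 0 < deriv F ((G ^^ Suc i) x)"
    and sum: "\<And>n. 2 * \<delta> * real n
        \<le> (\<Sum>i<n. ln (deriv F ((G ^^ Suc i) x)) + min (ln (deriv F ((G ^^ Suc i) x)) + M) 0)"
    and y: "\<bar>y - x\<bar> \<le> r"
  shows "(\<lambda>n. (G ^^ n) y - (G ^^ n) x) \<longlonglongrightarrow> 0"
proof -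
  define \<psi> where "\<psi> i = ln (deriv F ((G ^^ Suc i) x))" for i
  define S where "S n = (\<Sum>i<n. \<psi> i - \<delta>)" for n
  define R where "R n = r * exp (- S n)" for n
  have r0: "0 \<le> r" using y by linarith
  have sum': "2 * \<delta> * real n \<le> (\<Sum>i<n. \<psi> i) + (\<Sum>i<n. min (\<psi> i + M) 0)" for n
    using sum[of n] by (simp add: \<psi>_def sum.distrib)
  have S_eq: "S n = (\<Sum>i<n. \<psi> i) - \<delta> * real n" for n
    by (simp add: S_def sum_subtractf mult.commute)
  have S_ge: "\<delta> * real n \<le> S n" for n
  proof -
    have "(\<Sum>i<n. min (\<psi> i + M) 0) \<le> 0" by (intro sum_nonpos) simp
    then show ?thesis using sum'[of n] unfolding S_eq by linarith
  qed
  have R_le: "R n \<le> r * exp (- (\<delta> * real n))" for n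
    unfolding R_def using r0 S_ge[of n] by (intro mult_left_mono) auto
  \<comment> \<open>Of the additional terms only the last one is kept; the others are non-positive.\<close>
  have R_deriv: "R (Suc n) \<le> (r * exp M) * deriv F ((G ^^ Suc n) x)" for n
  proof -
    have "(\<Sum>i<n. min (\<psi> i + M) 0) \<le> 0" by (intro sum_nonpos) simp
    then have "2 * \<delta> * real (Suc n) \<le> (\<Sum>i<Suc n. \<psi> i) + min (\<psi> n + M) 0"
      using sum'[of "Suc n"] by simp
    moreover have "0 \<le> \<delta> * real (Suc n)" using \<delta> by simp
    ultimately have "- S (Suc n) \<le> M + \<psi> n" unfolding S_eq by linarith
    then have "R (Suc n) \<le> r * exp (M + \<psi> n)"
      unfolding R_def using r0 by (intro mult_left_mono) auto
    also have "\<dots> = (r * exp M) * deriv F ((G ^^ Suc n) x)"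
      using pos[of n] by (simp add: exp_add \<psi>_def)
    finally show ?thesis .
  qed
  have claim: "\<bar>(G ^^ n) y - (G ^^ n) x\<bar> \<le> R n" for n
  proof (cases "r = 0")
    case True
    then show ?thesis using y by (simp add: R_def)
  next
    case False
    then have r_pos: "0 < r" using r0 by simp
    show ?thesis
    proof (induction n)
      case 0
      then show ?case using y by (simp add: R_def S_def)
    next
      case (Suc n)
      \<comment> \<open>The image under \<open>F\<close> of the ball of radius \<open>R (n+1)\<close> around \<open>x\<^sub>n\<^sub>+\<^sub>1\<close> covers the ball of
        radius \<open>R n\<close> around \<open>x\<^sub>n\<close>.\<close>
      define v where "v = (G ^^ Suc n) x"
      define \<rho> where "\<rho> = R (Suc n)"
      have Fv: "F v = (G ^^ n) x" by (simp add: v_def)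
      have \<rho>: "0 < \<rho>" using r_pos by (simp add: \<rho>_def R_def)
      have step: "exp (\<psi> n - \<delta>) * \<rho> = R n"
        by (simp add: \<rho>_def R_def S_def flip: exp_add)
      have deriv_ge: "exp (\<psi> n - \<delta>) \<le> deriv F u" if "\<bar>u - v\<bar> \<le> \<rho>" for u
      proof -
        have "L * \<bar>u - v\<bar> \<le> L * ((r * exp M) * deriv F v)"
          using that R_deriv[of n] L_pos by (intro mult_left_mono) (auto simp: v_def \<rho>_def)
        also have "\<dots> \<le> (1 - exp (- \<delta>)) * deriv F v"
          using mult_right_mono[OF r deriv_nonneg[of v]] by (simp add: mult.assoc)
        finally have "exp (- \<delta>) * deriv F v \<le> deriv F u"
          using lipschitz[of u v] by (simp add: algebra_simps abs_le_iff)
        moreover have "exp (- \<delta>) * deriv F v = exp (\<psi> n - \<delta>)"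
          using pos[of n] by (simp add: \<psi>_def v_def exp_diff exp_minus field_simps)
        ultimately show ?thesis by simp
      qed
      have "R n \<le> F (v + \<rho>) - F v"
        using F_diff_ge[of v "v + \<rho>" "exp (\<psi> n - \<delta>)"] deriv_ge \<rho> step by simp
      then have "(G ^^ n) y \<le> F (v + \<rho>)" using Suc Fv by (simp add: abs_le_iff)
      moreover have "R n \<le> F v - F (v - \<rho>)"
        using F_diff_ge[of "v - \<rho>" v "exp (\<psi> n - \<delta>)"] deriv_ge \<rho> step by simp
      then have "F (v - \<rho>) \<le> (G ^^ n) y" using Suc Fv by (simp add: abs_le_iff)
      ultimately have "(G ^^ Suc n) y \<le> v + \<rho>" "v - \<rho> \<le> (G ^^ Suc n) y"
        by (simp_all add: G_le_iff le_G_iff)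
      then show ?case by (simp add: abs_le_iff v_def \<rho>_def)
    qed
  qed
  have lim: "(\<lambda>n. r * exp (- (\<delta> * real n))) \<longlonglongrightarrow> 0"
    using \<delta> by real_asymp
  have le: "norm ((G ^^ n) y - (G ^^ n) x) \<le> r * exp (- (\<delta> * real n))" for n
    using order_trans[OF claim[of n] R_le[of n]] by simp
  show ?thesis by (rule Lim_null_comparison[OF always_eventually lim]) (intro allI le)
qed

text \<open>If the mean \<open>m\<close> were positive, it would remain so after adding a small deep part of \<open>ln D\<close> and
  subtracting a constant. The maximal ergodic theorem for the inverse map then provides points
  whose backward orbits satisfy the hypothesis of the preceding lemma with one and the same radius,
  and one of them is recurrent.\<close>

lemma integral_log_deriv_nonpos:
  assumes inv: "invariant_borel_prob f \<mu>"
  shows "(\<integral>z. ln (D z) \<partial>\<mu>) \<le> 0"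
proof (rule ccontr)
  interpret prob_space \<mu> using inv by (simp add: invariant_borel_prob_def)
  note [measurable] = f_meas[OF inv] g_meas[OF inv] D_meas[OF inv]
  define m where "m = (\<integral>z. ln (D z) \<partial>\<mu>)"
  assume "\<not> ?thesis"
  then have m: "0 < m" by (simp add: m_def)
  note int = log_deriv_integrable(2)[OF inv]
  obtain M where M: "integrable \<mu> (\<lambda>z. min (ln (D z) + M) 0)"
      "- (m / 2) < (\<integral>z. min (ln (D z) + M) 0 \<partial>\<mu>)"
    using small_tail_integral[OF int, of "m / 2"] m by auto
  \<comment> \<open>Half of \<open>m\<close> is spent on the deep part and a quarter on \<open>2 \<delta>\<close>.\<close>
  define \<delta> where "\<delta> = m / 8"
  define r where "r = (1 - exp (- \<delta>)) / (L * exp M)"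
  define \<phi> where "\<phi> z = ln (D z) + min (ln (D z) + M) 0 - 2 * \<delta>" for z
  have \<delta>: "0 < \<delta>" and r: "0 < r" using m L_pos by (simp_all add: \<delta>_def r_def)
  have \<phi>_int: "integrable \<mu> \<phi>" unfolding \<phi>_def using int M by simp
  have [measurable]: "\<phi> \<in> borel_measurable \<mu>" using \<phi>_int by auto
  have [measurable]: "g ^^ i \<in> measurable \<mu> \<mu>" for i by (rule measurable_compose_n) measurable
  have \<phi>g_int: "integrable \<mu> (\<lambda>z. \<phi> (g z))" "(\<integral>z. \<phi> (g z) \<partial>\<mu>) = (\<integral>z. \<phi> z \<partial>\<mu>)"
    using integrable_distr[OF g_meas[OF inv], of \<phi>] integral_distr[OF g_meas[OF inv], of \<phi>]
      distr_g[OF inv] \<phi>_int by auto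
  have "(\<integral>z. \<phi> z \<partial>\<mu>) = m + (\<integral>z. min (ln (D z) + M) 0 \<partial>\<mu>) - 2 * \<delta>"
    unfolding \<phi>_def using int M by (simp add: m_def prob_space)
  then have "0 < (\<integral>z. \<phi> (g z) \<partial>\<mu>)" using m M(2) \<phi>g_int(2) by (simp add: \<delta>_def)
  then have nonnull: "\<not> (AE z in \<mu>. \<exists>n. (\<Sum>i<n. \<phi> (g ((g ^^ i) z))) < 0)"
    using maximal_ergodic[OF g_meas[OF inv] distr_g[OF inv] \<phi>g_int(1)] by fastforce
  define E where "E = {z \<in> space \<mu>. (\<forall>i. 0 < D (g ((g ^^ i) z))) \<and> (\<forall>n. 0 \<le> (\<Sum>i<n. \<phi> (g ((g ^^ i) z))))}"
  have "E \<in> sets \<mu>" unfolding E_def by measurable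
  moreover have "\<not> (AE z in \<mu>. z \<notin> E)"
  proof
    have "AE z in \<mu>. 0 < D ((g ^^ Suc i) z)" for i
    proof (rule AE_distrD[of "g ^^ Suc i" \<mu> \<mu>])
      show "g ^^ Suc i \<in> measurable \<mu> \<mu>" by measurable
      show "AE z in distr \<mu> \<mu> (g ^^ Suc i). 0 < D z"
        unfolding distr_funpow[OF g_meas[OF inv] distr_g[OF inv]] by (rule log_deriv_integrable(1)[OF inv])
    qed
    then have "AE z in \<mu>. \<forall>i. 0 < D (g ((g ^^ i) z))" unfolding AE_all_countable by simp
    moreover assume "AE z in \<mu>. z \<notin> E"
    ultimately have "AE z in \<mu>. \<exists>n. (\<Sum>i<n. \<phi> (g ((g ^^ i) z))) < 0"
      using AE_space by eventually_elim (auto simp: E_def not_le)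
    with nonnull show False by blast
  qed
  ultimately obtain x k p where x: "circle_proj x \<in> E" "1 \<le> k" "\<bar>(F ^^ k) x - of_int p - x\<bar> < r"
    using close_return[OF inv _ _ r] by metis
  have orbit: "D (g ((g ^^ i) (circle_proj x))) = deriv F ((G ^^ Suc i) x)" for i
    using D_proj[of "(G ^^ Suc i) x"] circle_proj_Gn[of "Suc i" x] by simp
  have pos: "0 < deriv F ((G ^^ Suc i) x)" for i
  proof -
    have "0 < D (g ((g ^^ i) (circle_proj x)))" using x(1) by (simp add: E_def)
    then show ?thesis unfolding orbit .
  qed
  have sum: "2 * \<delta> * real n
      \<le> (\<Sum>i<n. ln (deriv F ((G ^^ Suc i) x)) + min (ln (deriv F ((G ^^ Suc i) x)) + M) 0)" for n
  proof -
    have "0 \<le> (\<Sum>i<n. \<phi> (g ((g ^^ i) (circle_proj x))))" using x by (simp add: E_def)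
    then show ?thesis unfolding \<phi>_def orbit by (simp add: sum_subtractf algebra_simps)
  qed
  have "(\<lambda>n. (G ^^ n) y - (G ^^ n) x) \<longlonglongrightarrow> 0" if "\<bar>y - x\<bar> < r" for y
    by (rule deep_orbit_backward_contracts[OF \<delta> _ pos sum, of r]) (use that L_pos in \<open>auto simp: r_def\<close>)
  then show False using no_backward_contraction[OF x(2,3)] by blast
qed

end

section \<open>Empirical measures\<close>

text \<open>The indicator of an open set is an increasing limit of continuous functions.\<close>

lemma measure_eqI_continuous_on:
  fixes M N :: "'a::metric_space measure"
  assumes "prob_space M" "prob_space N" and C: "C \<in> sets borel"
    and sets: "sets M = sets (restrict_space borel C)" "sets N = sets (restrict_space borel C)"
    and eq: "\<And>u::'a \<Rightarrow> real. continuous_on C u \<Longrightarrow> (\<integral>z. u z \<partial>M) = (\<integral>z. u z \<partial>N)"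
  shows "M = N"
proof -
  interpret M: prob_space M by fact
  interpret N: prob_space N by fact
  have space: "space M = C" "space N = C"
    using sets_eq_imp_space_eq[OF sets(1)] sets_eq_imp_space_eq[OF sets(2)]
    by (simp_all add: space_restrict_space)
  have cont_meas: "u \<in> borel_measurable M" "u \<in> borel_measurable N"
    if "continuous_on C u" for u :: "'a \<Rightarrow> real"
    using borel_measurable_continuous_on_restrict[OF that] measurable_cong_sets[OF sets(1) refl]
      measurable_cong_sets[OF sets(2) refl] by blast+
  have generator: "sets (restrict_space borel C) = sigma_sets C ((\<inter>) C ` {U. open U})"
    unfolding sets_restrict_space sets_borel using C
    by (subst sigma_sets_Int) (auto simp: sets_borel)
  have open_eq: "measure M (C \<inter> U) = measure N (C \<inter> U)" if "open U" for U
  proof (cases "U = UNIV")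
    case True
    then show ?thesis using M.prob_space N.prob_space space by simp
  next
    case False
    define u where "u n z = min 1 (real n * infdist z (- U))" for n z
    have u_cont: "continuous_on C (u n)" for n
      unfolding u_def by (intro continuous_intros)
    have u_bound: "norm (u n z) \<le> 1" for n z
      unfolding u_def using infdist_nonneg[of z "- U"] by (simp add: abs_le_iff)
    have u_lim: "(\<lambda>n. u n z) \<longlonglongrightarrow> indicator U z" for z
    proof (cases "z \<in> U")
      case True
      then have pos: "0 < infdist z (- U)"
        using \<open>open U\<close> False in_closed_iff_infdist_zero[of "- U" z] infdist_nonneg[of z "- U"]
        by (auto simp: less_le)
      obtain N :: nat where N: "1 < real N * infdist z (- U)" using reals_Archimedean3[OF pos] by blast
      have "\<forall>\<^sub>F n in sequentially. u n z = indicator U z"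
      proof (rule eventually_sequentiallyI[of N])
        fix n assume "N \<le> n"
        then have "real N * infdist z (- U) \<le> real n * infdist z (- U)"
          using pos by (intro mult_right_mono) auto
        then show "u n z = indicator U z" using N True by (simp add: u_def)
      qed
      then show ?thesis by (rule tendsto_eventually)
    qed (simp add: u_def)
    have lim: "(\<lambda>n. \<integral>z. u n z \<partial>K) \<longlonglongrightarrow> measure K (C \<inter> U)"
      if K: "prob_space K" "space K = C" "C \<inter> U \<in> sets K" "\<And>n. u n \<in> borel_measurable K" for K
    proof -
      interpret prob_space K by fact
      have "(\<lambda>n. \<integral>z. u n z \<partial>K) \<longlonglongrightarrow> (\<integral>z. indicator (C \<inter> U) z \<partial>K)"
      proof (rule integral_dominated_convergence[where w = "\<lambda>_. 1"])
        show "AE z in K. (\<lambda>n. u n z) \<longlonglongrightarrow> indicator (C \<inter> U) z"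
          by (rule AE_I2) (use u_lim K(2) in \<open>auto simp: indicator_inter_arith\<close>)
      qed (use K u_bound in auto)
      moreover have "C \<inter> U \<inter> C = C \<inter> U" by blast
      ultimately show ?thesis using K by simp
    qed
    have "C \<inter> U \<in> sets (restrict_space borel C)"
      unfolding sets_restrict_space by (rule imageI) (use \<open>open U\<close> in simp)
    then have "(\<lambda>n. \<integral>z. u n z \<partial>M) \<longlonglongrightarrow> measure M (C \<inter> U)"
        "(\<lambda>n. \<integral>z. u n z \<partial>N) \<longlonglongrightarrow> measure N (C \<inter> U)"
      using lim[OF assms(1) space(1) _ cont_meas(1)[OF u_cont]]
        lim[OF assms(2) space(2) _ cont_meas(2)[OF u_cont]] by (simp_all only: sets)
    then show ?thesis using LIMSEQ_unique eq[OF u_cont] by simp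
  qed
  show ?thesis
  proof (rule measure_eqI_generator_eq[where \<Omega> = C and E = "(\<inter>) C ` {U. open U}" and A = "\<lambda>_. C"])
    show "Int_stable ((\<inter>) C ` {U. open U})"
    proof (rule Int_stableI)
      fix X Y assume "X \<in> (\<inter>) C ` {U. open U}" "Y \<in> (\<inter>) C ` {U. open U}"
      then obtain U V where "open U" "open V" "X = C \<inter> U" "Y = C \<inter> V" by blast
      then show "X \<inter> Y \<in> (\<inter>) C ` {U. open U}"
        by (intro image_eqI[of _ _ "U \<inter> V"]) auto
    qed
    show "range (\<lambda>_. C) \<subseteq> (\<inter>) C ` {U. open U}"
      by (auto intro: image_eqI[of _ _ UNIV])
    show "emeasure M X = emeasure N X" if "X \<in> (\<inter>) C ` {U. open U}" for X
      using that open_eq by (auto simp: M.emeasure_eq_measure N.emeasure_eq_measure)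
  qed (use generator sets in auto)
qed

text \<open>Helly's selection theorem for the averages of the first point masses of a sequence in the unit interval.\<close>

lemma weak_limit_on_unit_interval:
  fixes \<theta> :: "nat \<Rightarrow> real"
  assumes \<theta>: "\<And>i. 0 \<le> \<theta> i" "\<And>i. \<theta> i < 1"
  obtains r :: "nat \<Rightarrow> nat" and \<nu> :: "real measure"
  where "strict_mono r" "real_distribution \<nu>"
    "\<And>w B. continuous_on UNIV w \<Longrightarrow> (\<And>x. \<bar>w x\<bar> \<le> B) \<Longrightarrow>
       (\<lambda>n. (\<Sum>i\<le>r n. w (\<theta> i)) / real (Suc (r n))) \<longlonglongrightarrow> (\<integral>x. w x \<partial>\<nu> :: real)"
proof -
  define \<nu> where "\<nu> n = distr (measure_pmf (pmf_of_set {..n})) borel \<theta>" for n :: nat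
  have rd: "real_distribution (\<nu> n)" for n
    unfolding \<nu>_def real_distribution_def real_distribution_axioms_def
    by (auto intro!: measure_pmf.prob_space_distr)
  have "tight \<nu>"
    unfolding tight_def
  proof (intro conjI allI impI rd)
    fix \<epsilon> :: real assume "0 < \<epsilon>"
    have "measure (\<nu> n) {-1<..1} = 1" for n
    proof -
      have "\<theta> -` {-1<..1} = UNIV"
      proof -
        have "- 1 < \<theta> i" "\<theta> i \<le> 1" for i using \<theta>(1)[of i] \<theta>(2)[of i] by linarith+
        then show ?thesis by auto
      qed
      then show ?thesis by (simp add: \<nu>_def measure_distr)
    qed
    then show "\<exists>a b. a < b \<and> (\<forall>n. 1 - \<epsilon> < measure (\<nu> n) {a<..b})"
      using \<open>0 < \<epsilon>\<close> by (intro exI[of _ "-1"] exI[of _ 1]) simp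
  qed
  from tight_imp_convergent_subsubsequence[OF this strict_mono_id]
  obtain r K where r: "strict_mono r" "real_distribution K" "weak_conv_m (\<nu> \<circ> id \<circ> r) K" by blast
  have "(\<lambda>n. (\<Sum>i\<le>r n. w (\<theta> i)) / real (Suc (r n))) \<longlonglongrightarrow> (\<integral>x. w x \<partial>K)"
    if w: "continuous_on UNIV w" "\<And>x. \<bar>w x\<bar> \<le> B" for w :: "real \<Rightarrow> real" and B
  proof -
    have "(\<lambda>n. integral\<^sup>L ((\<nu> \<circ> id \<circ> r) n) w) \<longlonglongrightarrow> integral\<^sup>L K w"
      by (rule weak_conv_imp_integral_bdd_continuous_conv[OF _ r(2,3), of w B])
        (use rd w in \<open>auto simp: continuous_on_eq_continuous_at\<close>)
    moreover have "integral\<^sup>L ((\<nu> \<circ> id \<circ> r) n) w = (\<Sum>i\<le>r n. w (\<theta> i)) / real (Suc (r n))" for n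
    proof -
      have "w \<in> borel_measurable borel" using w(1) by (rule borel_measurable_continuous_onI)
      then show ?thesis
        by (simp add: \<nu>_def integral_distr integral_pmf_of_set)
    qed
    ultimately show ?thesis by simp
  qed
  then show ?thesis using that r by blast
qed

context aperiodic_circle_map
begin

text \<open>The Krylov-Bogolyubov construction. The orbit is represented by fractional parts on the line, where
  limit measures are available, and the limit is projected back to the circle. It is invariant
  because applying \<open>f\<close> changes an orbit sum of a bounded function only by its two end terms.\<close>

lemma empirical_limit:
  obtains \<mu> r where "invariant_borel_prob f \<mu>" "strict_mono (r :: nat \<Rightarrow> nat)"
    "\<And>u. continuous_on circle u \<Longrightarrow>
       (\<lambda>n. (\<Sum>i\<le>r n. u (circle_proj ((F ^^ i) t))) / real (Suc (r n))) \<longlonglongrightarrow> (\<integral>z. u z \<partial>\<mu> :: real)"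
proof -
  define \<theta> where "\<theta> i = frac ((F ^^ i) t)" for i
  have \<theta>_bounds: "0 \<le> \<theta> i" "\<theta> i < 1" for i by (simp_all add: \<theta>_def frac_lt_1)
  have proj_\<theta>: "circle_proj (\<theta> i) = circle_proj ((F ^^ i) t)" for i
    using circle_proj_add_int[of "\<theta> i" "\<lfloor>(F ^^ i) t\<rfloor>"] by (simp add: \<theta>_def frac_def)
  obtain r \<nu> where r: "strict_mono r" and \<nu>: "real_distribution \<nu>"
    and lim: "\<And>w B. continuous_on UNIV w \<Longrightarrow> (\<And>x. \<bar>w x\<bar> \<le> B) \<Longrightarrow>
       (\<lambda>n. (\<Sum>i\<le>r n. w (\<theta> i)) / real (Suc (r n))) \<longlonglongrightarrow> (\<integral>x. w x \<partial>\<nu> :: real)"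
    using weak_limit_on_unit_interval[of \<theta>, OF \<theta>_bounds] by blast
  interpret \<nu>: real_distribution \<nu> by (rule \<nu>)
  define \<mu> where "\<mu> = distr \<nu> (restrict_space borel circle) circle_proj"
  have proj_meas: "circle_proj \<in> measurable \<nu> (restrict_space borel circle)"
    using borel_measurable_continuous_onI[OF continuous_on_circle_proj]
    by (intro measurable_restrict_space2) (auto simp: measurable_cong_sets[OF \<nu>.events_eq_borel refl])
  have prob: "prob_space \<mu>" unfolding \<mu>_def by (rule \<nu>.prob_space_distr[OF proj_meas])
  have sets: "sets \<mu> = sets (restrict_space borel circle)" by (simp add: \<mu>_def)
  have conv: "(\<lambda>n. (\<Sum>i\<le>r n. u (circle_proj ((F ^^ i) t))) / real (Suc (r n))) \<longlonglongrightarrow> (\<integral>z. u z \<partial>\<mu>)"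
    if u: "continuous_on circle u" for u :: "complex \<Rightarrow> real"
  proof -
    have "bounded (u ` circle)"
      using compact_continuous_image[OF u] compact_imp_bounded by auto
    then obtain B where B: "\<And>z. z \<in> circle \<Longrightarrow> \<bar>u z\<bar> \<le> B" unfolding bounded_iff by fastforce
    have "continuous_on UNIV (\<lambda>x. u (circle_proj x))"
      by (rule continuous_on_compose2[OF u continuous_on_circle_proj]) auto
    from lim[OF this, of B] B
    have "(\<lambda>n. (\<Sum>i\<le>r n. u (circle_proj (\<theta> i))) / real (Suc (r n))) \<longlonglongrightarrow> (\<integral>x. u (circle_proj x) \<partial>\<nu>)"
      by simp
    moreover have "(\<integral>z. u z \<partial>\<mu>) = (\<integral>x. u (circle_proj x) \<partial>\<nu>)"
      unfolding \<mu>_def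
      by (rule integral_distr[OF proj_meas borel_measurable_continuous_on_restrict[OF u]])
    ultimately show ?thesis by (simp add: proj_\<theta>)
  qed
  have f_cont: "continuous_on circle f" and f_img: "f ` circle \<subseteq> circle"
    using homeo by (auto simp: homeomorphism_def)
  have f_meas: "f \<in> measurable \<mu> \<mu>"
  proof -
    have "f \<in> measurable (restrict_space borel circle) (restrict_space borel circle)"
      using f_img borel_measurable_continuous_on_restrict[OF f_cont]
      by (intro measurable_restrict_space2) (auto simp: space_restrict_space)
    then show ?thesis using measurable_cong_sets[OF sets sets] by blast
  qed
  have "distr \<mu> \<mu> f = \<mu>"
  proof (rule measure_eqI_continuous_on[of _ _ circle])
    show "prob_space (distr \<mu> \<mu> f)" by (rule prob_space.prob_space_distr[OF prob f_meas])
    fix u :: "complex \<Rightarrow> real" assume u: "continuous_on circle u"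
    have uf: "continuous_on circle (\<lambda>z. u (f z))"
      by (rule continuous_on_compose2[OF u f_cont f_img])
    define a where "a i = u (circle_proj ((F ^^ i) t))" for i
    have "bounded (u ` circle)"
      using compact_continuous_image[OF u] compact_imp_bounded by auto
    then obtain B where B: "\<And>z. z \<in> circle \<Longrightarrow> \<bar>u z\<bar> \<le> B" unfolding bounded_iff by fastforce
    have shift: "u (f (circle_proj ((F ^^ i) t))) = a (Suc i)" for i
      by (simp add: a_def circle_lift_proj[OF lift])
    have telescope: "(\<Sum>i\<le>n. a (Suc i)) = (\<Sum>i\<le>n. a i) + (a (Suc n) - a 0)" for n
      using sum_telescope[of a n] by (simp add: sum_subtractf)
    have "(\<lambda>n. (a (Suc (r n)) - a 0) / real (Suc (r n))) \<longlonglongrightarrow> 0"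
    proof (rule Lim_null_comparison[OF always_eventually])
      have "(\<lambda>n. (2 * B) / real (Suc n)) \<longlonglongrightarrow> 0" by real_asymp
      from LIMSEQ_subseq_LIMSEQ[OF this r]
      show "(\<lambda>n. (2 * B) / real (Suc (r n))) \<longlonglongrightarrow> 0" by (simp add: o_def)
      show "\<forall>n. norm ((a (Suc (r n)) - a 0) / real (Suc (r n))) \<le> (2 * B) / real (Suc (r n))"
      proof
        fix n
        have "\<bar>a (Suc (r n)) - a 0\<bar> \<le> 2 * B"
          using B[OF circle_proj_in_circle, of "(F ^^ Suc (r n)) t"] B[OF circle_proj_in_circle, of t]
          unfolding a_def by (simp add: abs_le_iff)
        then show "norm ((a (Suc (r n)) - a 0) / real (Suc (r n))) \<le> (2 * B) / real (Suc (r n))"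
          by (simp add: abs_divide divide_right_mono del: of_nat_Suc)
      qed
    qed
    from tendsto_add[OF conv[OF u, folded a_def] this]
    have "(\<lambda>n. (\<Sum>i\<le>r n. a (Suc i)) / real (Suc (r n))) \<longlonglongrightarrow> (\<integral>z. u z \<partial>\<mu>)"
      unfolding telescope add_divide_distrib by simp
    moreover have "(\<lambda>n. (\<Sum>i\<le>r n. a (Suc i)) / real (Suc (r n))) \<longlonglongrightarrow> (\<integral>z. u (f z) \<partial>\<mu>)"
      using conv[OF uf] by (simp add: shift)
    ultimately have "(\<integral>z. u (f z) \<partial>\<mu>) = (\<integral>z. u z \<partial>\<mu>)" by (rule LIMSEQ_unique[rotated])
    moreover have "u \<in> borel_measurable \<mu>"
      using borel_measurable_continuous_on_restrict[OF u] measurable_cong_sets[OF sets refl] by blast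
    ultimately show "(\<integral>z. u z \<partial>distr \<mu> \<mu> f) = (\<integral>z. u z \<partial>\<mu>)"
      using integral_distr[OF f_meas, of u] by simp
  qed (use prob sets in auto)
  then have "invariant_borel_prob f \<mu>" using prob sets by (simp add: invariant_borel_prob_def)
  then show ?thesis using that r conv by blast
qed

lemma DERIV_Fn: "((F ^^ n) has_real_derivative (\<Prod>i<n. deriv F ((F ^^ i) t))) (at t)"
proof (induction n)
  case (Suc n)
  from DERIV_chain2[OF DF Suc]
  show ?case by (simp add: mult.commute)
qed (simp add: id_def)

text \<open>The Collet-Eckmann condition bounds the averages of \<open>ln D\<close> along the orbit of the critical value
  from below by about \<open>ln l\<close>, hence also those of the larger continuous truncations. A limit of
  empirical measures then has a positive exponent, which is excluded. Truncation is essential here,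
  since \<open>ln D\<close> itself is only upper semicontinuous.\<close>

lemma not_collet_eckmann:
  assumes "c \<in> circle"
  shows "\<not> collet_eckmann f c"
proof
  assume "collet_eckmann f c"
  then obtain C l where C: "0 < C" and l: "1 < l"
    and growth: "\<And>n. C * l ^ n \<le> circle_deriv (f ^^ n) (f c)"
    unfolding collet_eckmann_def by blast
  obtain t0 where "c = circle_proj t0" using circle_proj_surj[OF assms] by blast
  then obtain t where t: "f c = circle_proj t" using circle_lift_proj[OF lift] by blast
  define d where "d i = deriv F ((F ^^ i) t)" for i
  have prod_ge: "C * l ^ n \<le> (\<Prod>i<n. d i)" for n
    using growth[of n] circle_deriv_eq[OF circle_lift_funpow[OF lift] DERIV_Fn] by (simp add: t d_def)
  have d_pos: "0 < d i" for i
  proof -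
    have "0 < (\<Prod>i<Suc i. d i)" by (rule less_le_trans[OF _ prod_ge]) (use C l in simp)
    then have "d i \<noteq> 0" by auto
    then show ?thesis using deriv_nonneg by (simp add: d_def less_le)
  qed
  have sum_ge: "ln C + real n * ln l \<le> (\<Sum>i<n. ln (d i))" for n
  proof -
    have "ln C + real n * ln l = ln (C * l ^ n)" using C l by (simp add: ln_mult ln_realpow)
    also have "\<dots> \<le> ln (\<Prod>i<n. d i)"
      using C l prod_ge by (subst ln_le_cancel_iff) (auto intro: prod_pos d_pos)
    also have "\<dots> = (\<Sum>i<n. ln (d i))" using d_pos by (intro ln_prod) (auto simp: less_le)
    finally show ?thesis .
  qed
  obtain \<mu> r where inv: "invariant_borel_prob f \<mu>" and r: "strict_mono (r :: nat \<Rightarrow> nat)"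
    and conv: "\<And>u. continuous_on circle u \<Longrightarrow>
       (\<lambda>n. (\<Sum>i\<le>r n. u (circle_proj ((F ^^ i) t))) / real (Suc (r n))) \<longlonglongrightarrow> (\<integral>z. u z \<partial>\<mu> :: real)"
    using empirical_limit[of t] by blast
  have lower: "ln l \<le> (\<integral>z. ln (max (D z) s) \<partial>\<mu>)" if s: "0 < s" for s
  proof (rule LIMSEQ_le)
    have "(\<lambda>n. ln C / real (Suc n) + ln l) \<longlonglongrightarrow> ln l" by real_asymp
    from LIMSEQ_subseq_LIMSEQ[OF this r]
    show "(\<lambda>n. ln C / real (Suc (r n)) + ln l) \<longlonglongrightarrow> ln l" by (simp add: o_def)
    show "(\<lambda>n. (\<Sum>i\<le>r n. ln (max (D (circle_proj ((F ^^ i) t))) s)) / real (Suc (r n)))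
        \<longlonglongrightarrow> (\<integral>z. ln (max (D z) s) \<partial>\<mu>)"
      by (rule conv[OF ln_max_cont[OF s]])
    have "ln C / real (Suc n) + ln l
        \<le> (\<Sum>i\<le>n. ln (max (D (circle_proj ((F ^^ i) t))) s)) / real (Suc n)" for n
    proof -
      have "ln C + real (Suc n) * ln l \<le> (\<Sum>i\<le>n. ln (d i))"
        using sum_ge[of "Suc n"] by (simp only: lessThan_Suc_atMost)
      also have "\<dots> \<le> (\<Sum>i\<le>n. ln (max (D (circle_proj ((F ^^ i) t))) s))"
      proof (rule sum_mono)
        fix i
        show "ln (d i) \<le> ln (max (D (circle_proj ((F ^^ i) t))) s)"
          using d_pos[of i] by (subst ln_le_cancel_iff) (auto simp: D_proj d_def)
      qed
      finally have "(ln C + real (Suc n) * ln l) / real (Suc n)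
          \<le> (\<Sum>i\<le>n. ln (max (D (circle_proj ((F ^^ i) t))) s)) / real (Suc n)"
        by (rule divide_right_mono) simp
      then show ?thesis by (simp add: add_divide_distrib del: of_nat_Suc)
    qed
    then show "\<exists>N. \<forall>n\<ge>N. ln C / real (Suc (r n)) + ln l
        \<le> (\<Sum>i\<le>r n. ln (max (D (circle_proj ((F ^^ i) t))) s)) / real (Suc (r n))" by blast
  qed
  have "ln l \<le> (\<integral>z. ln (D z) \<partial>\<mu>)"
    by (rule LIMSEQ_le_const[OF log_deriv_integrable(3)[OF inv]]) (intro exI allI impI lower, simp)
  then show False using integral_log_deriv_nonpos[OF inv] ln_gt_zero[OF l] by linarith
qed

end

section \<open>Critical circle maps\<close>

text \<open>The second derivative of a lift is continuous and periodic, hence bounded.\<close>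

lemma C2_circle_lift_deriv_lipschitz:
  assumes C2: "Ck_on 2 UNIV F" and deg: "\<And>t. F (t + 1) = F t + 1"
  obtains L where "0 < L" "\<And>t u. \<bar>deriv F t - deriv F u\<bar> \<le> L * \<bar>t - u\<bar>"
proof -
  have shift: "deriv H (t + 1) = deriv H t" if "\<And>t. H (t + 1) = H t + c" "\<And>t. H differentiable (at t)"
    for H :: "real \<Rightarrow> real" and c t
  proof -
    have "(H has_real_derivative deriv H (t + 1)) (at (t + 1))" "(H has_real_derivative deriv H t) (at t)"
      using that(2) by (simp_all add: DERIV_deriv_iff_real_differentiable)
    then have "((\<lambda>s. H s + c) has_real_derivative deriv H (t + 1)) (at t)"
        "((\<lambda>s. H s + c) has_real_derivative deriv H t + 0) (at t)"
      using DERIV_shift[of H _ t 1] that(1) DERIV_add[OF _ DERIV_const] by auto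
    then show ?thesis using DERIV_unique by fastforce
  qed
  have diff: "F differentiable (at t)" "deriv F differentiable (at t)"
    and cont: "continuous_on UNIV (deriv (deriv F))" for t
    using C2 unfolding Ck_on_def by (auto simp: numeral_2_eq_2 less_Suc_eq)
  have deriv_per: "deriv (deriv F) (t + 1) = deriv (deriv F) t + 0" for t
    using shift[of F 1, OF deg diff(1)] shift[of "deriv F" 0] diff(2) by simp
  have "bounded (deriv (deriv F) ` {0..1})"
    using continuous_on_subset[OF cont] compact_continuous_image compact_imp_bounded by blast
  then obtain B where B: "\<And>t. t \<in> {0..1} \<Longrightarrow> \<bar>deriv (deriv F) t\<bar> \<le> B"
    unfolding bounded_iff by fastforce
  have B': "\<bar>deriv (deriv F) t\<bar> \<le> B" for t
  proof -
    have "deriv (deriv F) (frac t + of_int \<lfloor>t\<rfloor>) = deriv (deriv F) (frac t)"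
      using add_int_equivariant[of "deriv (deriv F)" 0 "frac t" "\<lfloor>t\<rfloor>"] deriv_per by simp
    moreover have "frac t + of_int \<lfloor>t\<rfloor> = t" by (simp add: frac_def)
    moreover have "frac t \<in> {0..1}" using frac_lt_1[of t] by auto
    ultimately show ?thesis using B by metis
  qed
  have "\<bar>deriv F t - deriv F u\<bar> \<le> (\<bar>B\<bar> + 1) * \<bar>t - u\<bar>" for t u
  proof -
    have "norm (deriv F t - deriv F u) \<le> (\<bar>B\<bar> + 1) * norm (t - u)"
    proof (rule field_differentiable_bound[where S = UNIV and f' = "deriv (deriv F)"])
      show "(deriv F has_real_derivative deriv (deriv F) z) (at z)" for z
        using diff(2) by (simp add: DERIV_deriv_iff_real_differentiable)
      show "norm (deriv (deriv F) z) \<le> \<bar>B\<bar> + 1" for z using B'[of z] by simp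
    qed auto
    then show ?thesis by simp
  qed
  then show ?thesis using that[of "\<bar>B\<bar> + 1"] by auto
qed

lemma C3_critical_circle_map_aperiodic:
  assumes f: "C3_critical_circle_map f" and irr: "rotation_number f \<notin> \<rat>"
  obtains g F L where "aperiodic_circle_map f g F L"
proof -
  obtain g H F where g: "homeomorphism circle circle f g" and H: "circle_lift f H" "strict_mono H"
    and F: "circle_lift f F" "Ck_on 3 UNIV F"
    using f unfolding C3_critical_circle_map_def orientation_preserving_circle_homeo_def Ck_circle_map_def
    by blast
  obtain p :: int where "\<And>t. F t = H t + of_int p" using circle_lift_unique[OF H(1) F(1)] by metis
  then have mono: "strict_mono F" using H(2) by (simp add: strict_mono_def)
  have inj: "inj_on f circle" using g by (metis homeomorphism_apply1 inj_on_inverseI)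
  note deg = circle_homeo_lift_degree_one[OF F(1) inj mono]
  have diff: "F differentiable (at t)" "deriv F differentiable (at t)"
      "deriv (deriv F) differentiable (at t)" for t
    using F(2) unfolding Ck_on_def by (auto simp: numeral_3_eq_3 less_Suc_eq)
  then have "continuous_on UNIV (deriv (deriv F))"
    by (auto intro!: continuous_at_imp_continuous_on differentiable_imp_continuous_within)
  then have "Ck_on 2 UNIV F"
    using diff unfolding Ck_on_def by (auto simp: numeral_2_eq_2 less_Suc_eq)
  then obtain L where L: "0 < L" "\<And>t u. \<bar>deriv F t - deriv F u\<bar> \<le> L * \<bar>t - u\<bar>"
    using C2_circle_lift_deriv_lipschitz[of F, OF _ deg] by metis
  have "aperiodic_circle_map f g F L"
    by unfold_locales
      (use F(1) g mono diff(1) L periodic_imp_rotation_number_rational[OF F(1) mono deg] irr in auto)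
  then show ?thesis using that by blast
qed

theorem theorem1:
  fixes f :: "complex \<Rightarrow> complex"
  assumes "C3_critical_circle_map f"
    and "rotation_number f \<notin> \<rat>"
  shows "(\<forall>\<mu>. invariant_borel_prob f \<mu> \<longrightarrow>
            log_deriv_in_L1 f \<mu> \<and> (\<integral>z. ln (circle_deriv f z) \<partial>\<mu>) = 0)
       \<and> (\<forall>c\<in>critical_points f. \<not> collet_eckmann f c)"
proof -
  obtain g F L where "aperiodic_circle_map f g F L"
    using C3_critical_circle_map_aperiodic[OF assms] .
  then interpret aperiodic_circle_map f g F L .
  show ?thesis
  proof (intro conjI allI impI ballI)
    fix \<mu> assume inv: "invariant_borel_prob f \<mu>"
    have "AE z in \<mu>. z \<notin> critical_points f"
      using log_deriv_integrable(1)[OF inv] by eventually_elim (simp add: critical_points_def)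
    then show "log_deriv_in_L1 f \<mu>"
      using log_deriv_integrable(2)[OF inv] by (simp add: log_deriv_in_L1_def)
    have "0 \<le> (\<integral>z. ln (D z) \<partial>\<mu>)"
      by (rule LIMSEQ_le_const[OF log_deriv_integrable(3)[OF inv]])
        (intro exI allI impI integral_ln_max_nonneg[OF inv], simp)
    then show "(\<integral>z. ln (D z) \<partial>\<mu>) = 0"
      using integral_log_deriv_nonpos[OF inv] by simp
  next
    fix c assume "c \<in> critical_points f"
    then show "\<not> collet_eckmann f c"
      using not_collet_eckmann by (simp add: critical_points_def)
  qed
qed

end
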